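(* Let $(X,\mu)$ be a discrete-time BRW and $x,y\in X$. (1) There is local survival at $x$ starting from $x$ (i.e. $q(x,x)<1$) if and only if $M_s(x,x)>1$. (2) If $\sup\{M_s(w,w): w\in X,\ x\to w\to y\}>1$, then there is local survival at $y$ starting from $x$ (i.e. $q(x,y)<1$). Moreover, if the set $\{w\in X: x\to w\to y\}$ is finite, the converse holds: $q(x,y)<1$ implies $\sup\{M_s(w,w): x\to w\to y\}>1$.
   Context: $X$ is a finite or countable set and $S_X:=\{f:X\to\mathbb N:\sum_{y}f(y)<\infty\}$. A discrete-time BRW $(X,\mu)$ is given by probability measures $\mu_x$ on $S_X$ ($x\in X$): each particle at $x$ is replaced, independently, by $f(y)$ particles at each $y$, $f$ drawn from $\mu_x$; $\eta_n(x)$ is the number of particles at $x$ at generation $n$. First-moment matrix $m_{xy}:=\sum_f f(y)\mu_x(f)$, with entries $m^{(n)}_{xy}$ of $M^n$; $M_s(x,y):=\limsup_{n\to\infty}(m^{(n)}_{xy})^{1/n}$. $x\to y$ means there is a path $x=x_0,\dots,x_n=y$ ($n\ge0$) with $m_{x_ix_{i+1}}>0$; $x\rightleftharpoons y$ means $x\to y$ and $y\to x$. Standing assumption: in every $\rightleftharpoons$-class there is $y$ with $\mu_y(\{f:\sum_{w\rightleftharpoons y}f(w)=1\})<1$. $q(x,y)$ is the probability, starting from one particle at $x$, that $\eta_n(y)=0$ for all large $n$. *)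

theory Defs
  imports "HOL-Probability.Probability"
begin

text \<open>Offspring laws: mu x is a probability (mass function, S_X is countable) on
  configurations f :: 'x => nat.  The BRW is realised by an i.i.d. family of
  offspring draws omega(n,z,i) ~ mu z, for generation n, site z, particle index i.\<close>

definition brw_space :: "('x \<Rightarrow> ('x \<Rightarrow> nat) pmf) \<Rightarrow> (nat \<times> 'x \<times> nat \<Rightarrow> ('x \<Rightarrow> nat)) measure" where
  "brw_space \<mu> = (\<Pi>\<^sub>M k\<in>UNIV. measure_pmf (\<mu> (fst (snd k))))"

fun brw_config :: "'x \<Rightarrow> (nat \<times> 'x \<times> nat \<Rightarrow> ('x \<Rightarrow> nat)) \<Rightarrow> nat \<Rightarrow> 'x \<Rightarrow> nat" where
  "brw_config x0 \<omega> 0 = (\<lambda>y. if y = x0 then 1 else 0)"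
| "brw_config x0 \<omega> (Suc n) = (\<lambda>y. \<Sum>z\<in>{z. brw_config x0 \<omega> n z \<noteq> 0}.
       \<Sum>i<brw_config x0 \<omega> n z. \<omega> (n, z, i) y)"

definition q_ext :: "('x \<Rightarrow> ('x \<Rightarrow> nat) pmf) \<Rightarrow> 'x \<Rightarrow> 'x \<Rightarrow> real" where
  "q_ext \<mu> x y = measure (brw_space \<mu>)
     {\<omega> \<in> space (brw_space \<mu>). \<exists>N. \<forall>n\<ge>N. brw_config x \<omega> n y = 0}"

definition mom :: "('x \<Rightarrow> ('x \<Rightarrow> nat) pmf) \<Rightarrow> 'x \<Rightarrow> 'x \<Rightarrow> ennreal" where
  "mom \<mu> x y = (\<integral>\<^sup>+ f. of_nat (f y) \<partial>measure_pmf (\<mu> x))"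

fun mom_pow :: "('x \<Rightarrow> ('x \<Rightarrow> nat) pmf) \<Rightarrow> nat \<Rightarrow> 'x \<Rightarrow> 'x \<Rightarrow> ennreal" where
  "mom_pow \<mu> 0 x y = (if x = y then 1 else 0)"
| "mom_pow \<mu> (Suc n) x y = (\<integral>\<^sup>+ z. mom_pow \<mu> n x z * mom \<mu> z y \<partial>count_space UNIV)"

definition enn_root :: "nat \<Rightarrow> ennreal \<Rightarrow> ennreal" where
  "enn_root n v = (if v = \<top> then \<top> else ennreal (root n (enn2real v)))"

definition Ms :: "('x \<Rightarrow> ('x \<Rightarrow> nat) pmf) \<Rightarrow> 'x \<Rightarrow> 'x \<Rightarrow> ennreal" where
  "Ms \<mu> x y = limsup (\<lambda>n. enn_root n (mom_pow \<mu> n x y))"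

definition reach :: "('x \<Rightarrow> ('x \<Rightarrow> nat) pmf) \<Rightarrow> 'x \<Rightarrow> 'x \<Rightarrow> bool" where
  "reach \<mu> = (\<lambda>a b. mom \<mu> a b > 0)\<^sup>*\<^sup>*"

definition comm :: "('x \<Rightarrow> ('x \<Rightarrow> nat) pmf) \<Rightarrow> 'x \<Rightarrow> 'x \<Rightarrow> bool" where
  "comm \<mu> a b \<longleftrightarrow> reach \<mu> a b \<and> reach \<mu> b a"

end

theory Submission
  imports Defs
begin

text \<open>Let \<open>G h z\<close> be the expectation of \<open>\<Prod>w. h w ^ f w\<close> under \<open>\<mu> z\<close>, the generating functional of the BRW.
  The branching property turns the probability of not visiting \<open>y\<close> in generations \<open>N..N+m\<close> into an
  \<open>N\<close>-th iterate of \<open>G\<close>, so that \<open>z \<mapsto> q(z,y)\<close> is a fixed point of \<open>G\<close>.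

  If \<open>M\<^sub>s(w,w) > 1\<close>, then some entry \<open>m\<^sup>n(w,w)\<close> exceeds 1, hence \<open>G\<^sup>n (1 - t 1\<^sub>w) \<le> 1 - t 1\<^sub>w\<close> for all small
  \<open>t > 0\<close>; iterating keeps the probability of a visit to \<open>w\<close>, and so to \<open>y\<close>, bounded away from 0 along
  a sequence of generations.

  If \<open>M\<^sub>s(x,x) \<le> 1\<close>, the renewal equation shows that the expected number \<open>F x\<close> of first returns to \<open>x\<close> is
  at most 1. Any fixed point \<open>Q\<close> satisfies \<open>v \<le> M v\<close> for \<open>v = 1 - Q\<close>; iterating this up to the first
  visit of \<open>x\<close> gives \<open>v \<le> v x \<sqdot> F\<close>, provided \<open>v\<close> is bounded by a multiple of \<open>F\<close>. If \<open>v x > 0\<close>, all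
  these inequalities are equalities along all paths from \<open>x\<close>. Equality in \<open>1 - G (1 - v) \<le> M v\<close> means that
  a particle in the class of \<open>x\<close> has at most one child in the class, and \<open>F x = 1\<close> (recurrence of the
  resulting substochastic chain) that it has exactly one, contrary to the standing assumption. The
  case of finitely many intermediate sites is reduced to this one by choosing an extremal site among those with \<open>v > 0\<close>.\<close>

section \<open>Configurations and the offspring array\<close>

definition supp :: "('x \<Rightarrow> nat) \<Rightarrow> 'x set" where
  "supp g = {z. g z \<noteq> 0}"

definition pw :: "('x \<Rightarrow> real) \<Rightarrow> ('x \<Rightarrow> nat) \<Rightarrow> real" where
  "pw h g = (\<Prod>z\<in>supp g. h z ^ g z)"

lemma pw_superset:
  assumes "finite S" "supp g \<subseteq> S"
  shows "pw h g = (\<Prod>z\<in>S. h z ^ g z)"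
  unfolding pw_def using assms by (intro prod.mono_neutral_left) (auto simp: supp_def)

lemma pw_infinite: "infinite (supp g) \<Longrightarrow> pw h g = 1"
  by (simp add: pw_def)

lemma pw_zero [simp]: "pw h (\<lambda>_. 0) = 1"
  by (simp add: pw_def supp_def)

lemma pw_add:
  assumes "finite (supp f)" "finite (supp g)"
  shows "pw h (\<lambda>y. f y + g y) = pw h f * pw h g"
proof -
  let ?S = "supp f \<union> supp g"
  have "supp (\<lambda>y. f y + g y) \<subseteq> ?S"
    by (auto simp: supp_def)
  then show ?thesis
    using assms by (simp add: pw_superset[of ?S] power_add prod.distrib)
qed

lemma finite_supp_sum:
  assumes "finite K" "\<And>k. k \<in> K \<Longrightarrow> finite (supp (f k))"
  shows "finite (supp (\<lambda>y. \<Sum>k\<in>K. f k y))"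
proof (rule finite_subset)
  show "supp (\<lambda>y. \<Sum>k\<in>K. f k y) \<subseteq> (\<Union>k\<in>K. supp (f k))"
    using assms(1) by (auto simp: supp_def)
qed (use assms in auto)

lemma pw_sum:
  assumes "finite K" "\<And>k. k \<in> K \<Longrightarrow> finite (supp (f k))"
  shows "pw h (\<lambda>y. \<Sum>k\<in>K. f k y) = (\<Prod>k\<in>K. pw h (f k))"
  using assms
proof (induction K rule: finite_induct)
  case (insert k K)
  then show ?case
    by (simp add: pw_add finite_supp_sum)
qed simp

lemma countable_finite_supp: "countable {g :: 'x::countable \<Rightarrow> nat. finite (supp g)}"
proof -
  let ?e = "\<lambda>g :: 'x \<Rightarrow> nat. (\<lambda>z. (z, g z)) ` supp g"
  have "inj_on ?e {g. finite (supp g)}"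
  proof (rule inj_onI, rule ext)
    fix f g :: "'x \<Rightarrow> nat" and z
    assume eq: "?e f = ?e g"
    have "(z, k) \<in> ?e f \<longleftrightarrow> f z = k \<and> k \<noteq> 0" "(z, k) \<in> ?e g \<longleftrightarrow> g z = k \<and> k \<noteq> 0" for k
      by (auto simp: supp_def image_iff)
    then show "f z = g z"
      using eq by metis
  qed
  moreover have "countable (?e ` {g. finite (supp g)})"
    by (rule countable_subset[OF _ countable_Collect_finite]) auto
  ultimately show ?thesis
    by (simp add: countable_image_inj_eq)
qed

lemma brw_config_cong:
  assumes "\<And>k. fst k < n \<Longrightarrow> \<omega> k = \<omega>' k"
  shows "brw_config x \<omega> n = brw_config x \<omega>' n"
  using assms
proof (induction n)
  case (Suc n)
  then have "brw_config x \<omega> n = brw_config x \<omega>' n"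
    by simp
  moreover have "\<omega> (n, z, i) = \<omega>' (n, z, i)" for z i
    using Suc.prems by simp
  ultimately show ?case
    by simp
qed simp

locale brw =
  fixes \<mu> :: "'x::countable \<Rightarrow> ('x \<Rightarrow> nat) pmf"
  assumes fin_supp: "\<And>z f. f \<in> set_pmf (\<mu> z) \<Longrightarrow> finite (supp f)"
begin

abbreviation "\<Omega> \<equiv> brw_space \<mu>"

definition gen :: "('x \<Rightarrow> real) \<Rightarrow> 'x \<Rightarrow> real" where
  "gen h z = (\<integral>f. pw h f \<partial>measure_pmf (\<mu> z))"

lemma prob_space_brw: "prob_space \<Omega>"
  unfolding brw_space_def by (intro prob_space_PiM measure_pmf.prob_space_axioms)

sublocale P: prob_space \<Omega>
  by (rule prob_space_brw)

lemma space_brw [simp]: "space \<Omega> = UNIV"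
  by (auto simp: brw_space_def space_PiM)

lemma measurable_coord [measurable]:
  "(\<lambda>\<omega>. H (\<omega> k)) \<in> measurable \<Omega> (count_space UNIV)"
proof -
  have "(\<lambda>\<omega>. \<omega> k) \<in> measurable \<Omega> (measure_pmf (\<mu> (fst (snd k))))"
    unfolding brw_space_def by measurable
  then have "(\<lambda>\<omega>. \<omega> k) \<in> measurable \<Omega> (count_space UNIV)"
    by (simp cong: measurable_cong_sets)
  then show ?thesis
    by (rule measurable_compose) simp
qed

lemma measurable_coord_borel [measurable]:
  "(\<lambda>\<omega>. (H (\<omega> k) :: ennreal)) \<in> borel_measurable \<Omega>"
  by (rule measurable_compose[OF measurable_coord[of "\<lambda>f. f" k]]) simp

lemma nn_integral_mult_coord:
  assumes [measurable]: "F \<in> borel_measurable \<Omega>"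
    and F: "\<And>\<omega> f. F (fun_upd \<omega> k f) = F \<omega>"
  shows "(\<integral>\<^sup>+\<omega>. F \<omega> * H (\<omega> k) \<partial>\<Omega>) = (\<integral>\<^sup>+\<omega>. F \<omega> \<partial>\<Omega>) * (\<integral>\<^sup>+f. H f \<partial>\<mu> (fst (snd k)))"
proof -
  let ?N = "measure_pmf (\<mu> (fst (snd k)))"
  have [measurable]: "H \<in> borel_measurable ?N"
    by simp
  have upd: "(\<lambda>(f, \<omega>). fun_upd \<omega> k f) \<in> measurable (?N \<Otimes>\<^sub>M \<Omega>) \<Omega>"
    unfolding brw_space_def case_prod_beta by (rule measurable_fun_upd[where J=UNIV]; measurable)
  have \<Omega>: "\<Omega> = distr (?N \<Otimes>\<^sub>M \<Omega>) \<Omega> (\<lambda>(f, \<omega>). fun_upd \<omega> k f)"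
    using distr_pair_PiM_eq_PiM[of UNIV "\<lambda>k. measure_pmf (\<mu> (fst (snd k)))" k]
    by (simp add: brw_space_def measure_pmf.prob_space_axioms)
  have "(\<integral>\<^sup>+\<omega>. F \<omega> * H (\<omega> k) \<partial>\<Omega>) = (\<integral>\<^sup>+p. F (fun_upd (snd p) k (fst p)) * H (fst p) \<partial>(?N \<Otimes>\<^sub>M \<Omega>))"
    by (subst \<Omega>, subst nn_integral_distr[OF upd]) (auto simp: case_prod_beta)
  also have "\<dots> = (\<integral>\<^sup>+p. F (snd p) * H (fst p) \<partial>(?N \<Otimes>\<^sub>M \<Omega>))"
    by (simp add: F)
  also have "\<dots> = (\<integral>\<^sup>+f. \<integral>\<^sup>+\<omega>. F \<omega> * H f \<partial>\<Omega> \<partial>?N)"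
    by (subst P.nn_integral_fst[symmetric]) simp_all
  also have "\<dots> = (\<integral>\<^sup>+\<omega>. F \<omega> \<partial>\<Omega>) * (\<integral>\<^sup>+f. H f \<partial>?N)"
    by (simp add: nn_integral_multc nn_integral_cmult)
  finally show ?thesis .
qed

lemma nn_integral_mult_coords:
  assumes "finite K" and F[measurable]: "F \<in> borel_measurable \<Omega>"
    and "\<And>\<omega> k f. k \<in> K \<Longrightarrow> F (fun_upd \<omega> k f) = F \<omega>"
  shows "(\<integral>\<^sup>+\<omega>. F \<omega> * (\<Prod>k\<in>K. H (\<omega> k)) \<partial>\<Omega>) =
    (\<integral>\<^sup>+\<omega>. F \<omega> \<partial>\<Omega>) * (\<Prod>k\<in>K. \<integral>\<^sup>+f. H f \<partial>\<mu> (fst (snd k)))"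
  using assms(1,3)
proof (induction K rule: finite_induct)
  case (insert k K)
  have "(\<integral>\<^sup>+\<omega>. F \<omega> * (\<Prod>k\<in>insert k K. H (\<omega> k)) \<partial>\<Omega>) =
      (\<integral>\<^sup>+\<omega>. (F \<omega> * (\<Prod>k\<in>K. H (\<omega> k))) * H (\<omega> k) \<partial>\<Omega>)"
    using insert by (simp add: ac_simps)
  also have "\<dots> = (\<integral>\<^sup>+\<omega>. F \<omega> * (\<Prod>k\<in>K. H (\<omega> k)) \<partial>\<Omega>) * (\<integral>\<^sup>+f. H f \<partial>\<mu> (fst (snd k)))"
  proof (rule nn_integral_mult_coord)
    fix \<omega> f
    have "(\<Prod>l\<in>K. H ((fun_upd \<omega> k f) l)) = (\<Prod>l\<in>K. H (\<omega> l))"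
      using insert by (intro prod.cong) auto
    moreover have "F (fun_upd \<omega> k f) = F \<omega>"
      by (rule insert.prems) simp
    ultimately show "F (fun_upd \<omega> k f) * (\<Prod>l\<in>K. H (fun_upd \<omega> k f l)) = F \<omega> * (\<Prod>l\<in>K. H (\<omega> l))"
      by (simp only:)
  qed auto
  finally show ?case
    using insert by (simp add: ac_simps)
qed simp

text \<open>Configurations with infinitely many occupied sites occur on a null set only, but measurability
  has to hold everywhere. The sum defining the next generation vanishes on them, so they may be
  replaced by the empty configuration, which leaves countably many values.\<close>

definition fin_config :: "'x \<Rightarrow> (nat \<times> 'x \<times> nat \<Rightarrow> 'x \<Rightarrow> nat) \<Rightarrow> nat \<Rightarrow> 'x \<Rightarrow> nat" where
  "fin_config x \<omega> n = (if finite (supp (brw_config x \<omega> n)) then brw_config x \<omega> n else (\<lambda>_. 0))"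

lemma brw_config_Suc_fin_config:
  "brw_config x \<omega> (Suc n) y =
     (\<Sum>z\<in>supp (fin_config x \<omega> n). \<Sum>i<fin_config x \<omega> n z. \<omega> (n, z, i) y)"
  by (auto simp: fin_config_def supp_def)

lemma measurable_fin_configI:
  assumes [measurable]: "\<And>y. (\<lambda>\<omega>. brw_config x \<omega> n y) \<in> measurable \<Omega> (count_space UNIV)"
  shows "(\<lambda>\<omega>. fin_config x \<omega> n) \<in> measurable \<Omega> (count_space {g. finite (supp g)})"
proof -
  have m: "{\<omega>. brw_config x \<omega> n = g} \<in> sets \<Omega>" for g
  proof -
    have "{\<omega> \<in> space \<Omega>. \<forall>y. brw_config x \<omega> n y = g y} \<in> sets \<Omega>"
      by measurable
    then show ?thesis
      by (simp add: fun_eq_iff)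
  qed
  have inf: "{\<omega>. infinite (supp (brw_config x \<omega> n))} \<in> sets \<Omega>"
  proof -
    have "{\<omega>. infinite (supp (brw_config x \<omega> n))} =
        space \<Omega> - (\<Union>g\<in>{g. finite (supp g)}. {\<omega>. brw_config x \<omega> n = g})"
      by auto
    also have "\<dots> \<in> sets \<Omega>"
      by (intro sets.Diff sets.top sets.countable_UN' countable_finite_supp) (use m in auto)
    finally show ?thesis .
  qed
  have "{\<omega>. fin_config x \<omega> n = g} \<in> sets \<Omega>" if "finite (supp g)" for g
  proof (cases "g = (\<lambda>_. 0)")
    case True
    have "{\<omega>. fin_config x \<omega> n = g} =
        {\<omega>. brw_config x \<omega> n = g} \<union> {\<omega>. infinite (supp (brw_config x \<omega> n))}"
      using that by (auto simp: fin_config_def True)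
    then show ?thesis
      using m inf by auto
  next
    case False
    have "{\<omega>. fin_config x \<omega> n = g} = {\<omega>. brw_config x \<omega> n = g}"
      using that False by (auto simp: fin_config_def)
    then show ?thesis
      using m by auto
  qed
  then show ?thesis
    by (subst measurable_count_space_eq_countable[OF countable_finite_supp])
       (auto simp: vimage_def fin_config_def supp_def)
qed

lemma measurable_brw_config [measurable]:
  "(\<lambda>\<omega>. brw_config x \<omega> n y) \<in> measurable \<Omega> (count_space UNIV)"
proof (induction n arbitrary: y)
  case (Suc n)
  have "(\<lambda>\<omega>. \<Sum>z\<in>supp (fin_config x \<omega> n). \<Sum>i<fin_config x \<omega> n z. \<omega> (n, z, i) y)
      \<in> measurable \<Omega> (count_space UNIV)"
    by (rule measurable_compose_countable'[where f="\<lambda>g \<omega>. \<Sum>z\<in>supp g. \<Sum>i<g z. \<omega> (n, z, i) y",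
          OF _ measurable_fin_configI countable_finite_supp])
       (use Suc in \<open>auto\<close>)
  then show ?case
    by (subst brw_config_Suc_fin_config)
qed simp

lemma measurable_fin_config [measurable]:
  "(\<lambda>\<omega>. fin_config x \<omega> n) \<in> measurable \<Omega> (count_space {g. finite (supp g)})"
  by (rule measurable_fin_configI) measurable

lemma pw_fin_config: "pw h (fin_config x \<omega> n) = pw h (brw_config x \<omega> n)"
  by (simp add: fin_config_def pw_infinite)

lemma measurable_pw_config [measurable]:
  "(\<lambda>\<omega>. pw h (brw_config x \<omega> n)) \<in> borel_measurable \<Omega>"
  unfolding pw_fin_config[symmetric]
  by (rule measurable_compose[OF measurable_fin_config]) simp

lemma AE_coords_fin_supp: "AE \<omega> in \<Omega>. \<forall>k. finite (supp (\<omega> k))"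
proof -
  have "AE \<omega> in \<Omega>. finite (supp (\<omega> k))" for k
    unfolding brw_space_def
    by (rule AE_PiM_component) (auto simp: measure_pmf.prob_space_axioms AE_measure_pmf_iff fin_supp)
  then show ?thesis
    by (simp add: AE_all_countable)
qed

lemma finite_supp_config:
  assumes "\<And>k. finite (supp (\<omega> k))"
  shows "finite (supp (brw_config x \<omega> n))"
proof (induction n)
  case 0
  then show ?case
    by (auto simp: supp_def)
next
  case (Suc n)
  have "brw_config x \<omega> (Suc n) =
      (\<lambda>y. \<Sum>z\<in>supp (brw_config x \<omega> n). \<Sum>i<brw_config x \<omega> n z. \<omega> (n, z, i) y)"
    by (auto simp: supp_def)
  then show ?case
    using assms Suc by (simp del: brw_config.simps add: finite_supp_sum)
qed

lemma AE_finite_supp_config: "AE \<omega> in \<Omega>. finite (supp (brw_config x \<omega> n))"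
  using AE_coords_fin_supp by eventually_elim (rule finite_supp_config, auto)

end

section \<open>The generating functional\<close>

lemma pw_nonneg: "(\<And>z. 0 \<le> h z) \<Longrightarrow> 0 \<le> pw h g"
  by (simp add: pw_def prod_nonneg)

lemma pw_le_1: "(\<And>z. 0 \<le> h z \<and> h z \<le> 1) \<Longrightarrow> pw h g \<le> 1"
  by (simp add: pw_def prod_le_1 power_le_one)

lemma pw_mono: "(\<And>z. 0 \<le> h z \<and> h z \<le> h' z) \<Longrightarrow> pw h g \<le> pw h' g"
  unfolding pw_def by (intro prod_mono) (auto intro: power_mono)

lemma pw_avoid:
  assumes "finite (supp g)"
  shows "pw (\<lambda>z. if z = y then 0 else h z) g = (if g y = 0 then pw h g else 0)"
proof (cases "g y = 0")
  case True
  then show ?thesis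
    unfolding pw_def by (auto simp: supp_def intro!: prod.cong)
next
  case False
  then have "y \<in> supp g"
    by (simp add: supp_def)
  then show ?thesis
    unfolding pw_def using assms False by (auto intro!: prod_zero)
qed

definition unit_fun :: "('x \<Rightarrow> real) \<Rightarrow> bool" where
  "unit_fun h \<longleftrightarrow> (\<forall>z. 0 \<le> h z \<and> h z \<le> 1)"

lemma pw_unit: "unit_fun h \<Longrightarrow> 0 \<le> pw h g \<and> pw h g \<le> 1"
  by (simp add: unit_fun_def pw_nonneg pw_le_1)

context brw
begin

lemma integrable_pw: "unit_fun h \<Longrightarrow> integrable (measure_pmf (\<mu> z)) (pw h)"
  by (rule measure_pmf.integrable_const_bound[where B=1]) (use pw_unit[of h] in auto)

lemma gen_unit: 
  assumes "unit_fun h" 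
  shows "unit_fun (gen h)"
  unfolding unit_fun_def gen_def
proof (intro allI conjI)
  fix z
  show "0 \<le> (\<integral>f. pw h f \<partial>measure_pmf (\<mu> z))"
    using pw_unit[OF assms] by (simp add: integral_nonneg)
  have "(\<integral>f. pw h f \<partial>measure_pmf (\<mu> z)) \<le> (\<integral>f. 1 \<partial>measure_pmf (\<mu> z))"
    by (intro integral_mono integrable_pw assms) (use pw_unit[OF assms] in auto)
  then show "(\<integral>f. pw h f \<partial>measure_pmf (\<mu> z)) \<le> 1"
    by simp
qed

lemma ennreal_gen:
  assumes "unit_fun h"
  shows "ennreal (gen h z) = (\<integral>\<^sup>+f. ennreal (pw h f) \<partial>measure_pmf (\<mu> z))"
  unfolding gen_def using pw_unit[OF assms]
  by (subst nn_integral_eq_integral) (auto intro: integrable_pw assms)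

lemma gen_iter_unit: "unit_fun h \<Longrightarrow> unit_fun ((gen ^^ n) h)"
  by (induction n) (auto simp: gen_unit)

lemma gen_mono:
  assumes "unit_fun h" "unit_fun h'" "\<And>z. h z \<le> h' z"
  shows "gen h z \<le> gen h' z"
  unfolding gen_def
  by (intro integral_mono integrable_pw assms pw_mono) (use assms in \<open>auto simp: unit_fun_def\<close>)

lemma gen_iter_mono:
  assumes "unit_fun h" "unit_fun h'" "\<And>z. h z \<le> h' z"
  shows "(gen ^^ n) h z \<le> (gen ^^ n) h' z"
  using assms by (induction n arbitrary: z) (auto intro: gen_mono gen_iter_unit)

lemma gen_tendsto:
  assumes "\<And>n. unit_fun (h n)" "\<And>z. (\<lambda>n. h n z) \<longlonglongrightarrow> h' z"
  shows "(\<lambda>n. gen (h n) z) \<longlonglongrightarrow> gen h' z"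
  unfolding gen_def
proof (rule integral_dominated_convergence[where w="\<lambda>_. 1"])
  show "AE f in measure_pmf (\<mu> z). (\<lambda>n. pw (h n) f) \<longlonglongrightarrow> pw h' f"
    unfolding pw_def by (intro AE_I2 tendsto_intros assms)
qed (use pw_unit[OF assms(1)] in auto)

lemma gen_iter_tendsto:
  assumes "\<And>n. unit_fun (h n)" "\<And>z. (\<lambda>n. h n z) \<longlonglongrightarrow> h' z"
  shows "(\<lambda>n. (gen ^^ N) (h n) z) \<longlonglongrightarrow> (gen ^^ N) h' z"
  using assms by (induction N arbitrary: z) (auto intro!: gen_tendsto gen_iter_unit)

definition adapted :: "nat \<Rightarrow> ((nat \<times> 'x \<times> nat \<Rightarrow> 'x \<Rightarrow> nat) \<Rightarrow> ennreal) \<Rightarrow> bool" where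
  "adapted n \<phi> \<longleftrightarrow> \<phi> \<in> borel_measurable \<Omega> \<and>
     (\<forall>\<omega> \<omega>'. (\<forall>k. fst k < n \<longrightarrow> \<omega> k = \<omega>' k) \<longrightarrow> \<phi> \<omega> = \<phi> \<omega>')"

lemma adapted_measurable: "adapted n \<phi> \<Longrightarrow> \<phi> \<in> borel_measurable \<Omega>"
  by (simp add: adapted_def)

lemma adapted_mono: "adapted m \<phi> \<Longrightarrow> m \<le> n \<Longrightarrow> adapted n \<phi>"
  unfolding adapted_def by (meson le_trans less_le_trans)

lemma adapted_mult: "adapted n \<phi> \<Longrightarrow> adapted n \<psi> \<Longrightarrow> adapted n (\<lambda>\<omega>. \<phi> \<omega> * \<psi> \<omega>)"
  unfolding adapted_def by (intro conjI borel_measurable_times_ennreal; metis)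

lemma adapted_config:
  assumes "(\<lambda>\<omega>. indicator {\<omega>. R (brw_config x \<omega> n)} \<omega> :: ennreal) \<in> borel_measurable \<Omega>"
  shows "adapted n (indicator {\<omega>. R (brw_config x \<omega> n)})"
  unfolding adapted_def
proof (intro conjI allI impI)
  fix \<omega> \<omega>' :: "nat \<times> 'x \<times> nat \<Rightarrow> 'x \<Rightarrow> nat"
  assume "\<forall>k. fst k < n \<longrightarrow> \<omega> k = \<omega>' k"
  then have "brw_config x \<omega> n = brw_config x \<omega>' n"
    by (intro brw_config_cong) auto
  then show "(indicator {\<omega>. R (brw_config x \<omega> n)} \<omega> :: ennreal) = indicator {\<omega>. R (brw_config x \<omega> n)} \<omega>'"
    by (simp add: indicator_def)
qed (use assms in simp)

lemma sets_config_eq [measurable]: "{\<omega>. brw_config x \<omega> n = g} \<in> sets \<Omega>"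
proof -
  have "{\<omega> \<in> space \<Omega>. \<forall>y. brw_config x \<omega> n y = g y} \<in> sets \<Omega>"
    by measurable
  then show ?thesis
    by (simp add: fun_eq_iff)
qed

lemma adapted_upd:
  assumes "adapted n \<phi>" "n \<le> fst k"
  shows "\<phi> (fun_upd \<omega> k f) = \<phi> \<omega>"
proof -
  have "\<forall>k'. fst k' < n \<longrightarrow> (fun_upd \<omega> k f) k' = \<omega> k'"
    using assms(2) by auto
  then show ?thesis
    using assms(1) unfolding adapted_def by blast
qed

lemma branching_step_on:
  assumes \<phi>: "adapted n \<phi>" and h: "unit_fun h" and g: "finite (supp g)"
  shows "(\<integral>\<^sup>+\<omega>. \<phi> \<omega> * indicator {\<omega>. brw_config x \<omega> n = g} \<omega> * ennreal (pw h (brw_config x \<omega> (Suc n))) \<partial>\<Omega>) =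
    (\<integral>\<^sup>+\<omega>. \<phi> \<omega> * indicator {\<omega>. brw_config x \<omega> n = g} \<omega> * ennreal (pw (gen h) (brw_config x \<omega> n)) \<partial>\<Omega>)"
proof -
  define F where "F = (\<lambda>\<omega>. \<phi> \<omega> * indicator {\<omega>. brw_config x \<omega> n = g} \<omega>)"
  have F: "adapted n F"
    unfolding F_def by (intro adapted_mult \<phi> adapted_config) measurable
  note [measurable] = adapted_measurable[OF F]
  define I where "I = (SIGMA z:supp g. {..<g z})"
  define K where "K = (\<lambda>p. (n, p)) ` I"
  have fin: "finite I" "finite K"
    using g by (auto simp: I_def K_def)
  have inj: "inj_on (\<lambda>p. (n, p)) I"
    by (auto simp: inj_on_def)
  have "(\<integral>\<^sup>+\<omega>. F \<omega> * ennreal (pw h (brw_config x \<omega> (Suc n))) \<partial>\<Omega>) =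
      (\<integral>\<^sup>+\<omega>. F \<omega> * (\<Prod>k\<in>K. ennreal (pw h (\<omega> k))) \<partial>\<Omega>)"
  proof (rule nn_integral_cong_AE, use AE_coords_fin_supp in eventually_elim)
    fix \<omega> :: "nat \<times> 'x \<times> nat \<Rightarrow> 'x \<Rightarrow> nat"
    assume \<omega>: "\<forall>k. finite (supp (\<omega> k))"
    show "F \<omega> * ennreal (pw h (brw_config x \<omega> (Suc n))) = F \<omega> * (\<Prod>k\<in>K. ennreal (pw h (\<omega> k)))"
    proof (cases "brw_config x \<omega> n = g")
      case True
      have "(\<Sum>k\<in>K. \<omega> k y) = (\<Sum>z\<in>supp g. \<Sum>i<g z. \<omega> (n, z, i) y)" for y
      proof -
        have "(\<Sum>k\<in>K. \<omega> k y) = (\<Sum>p\<in>I. \<omega> (n, p) y)"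
          by (simp add: K_def sum.reindex[OF inj])
        also have "\<dots> = (\<Sum>z\<in>supp g. \<Sum>i<g z. \<omega> (n, z, i) y)"
          unfolding I_def using g by (subst sum.Sigma) (auto intro!: sum.cong)
        finally show ?thesis .
      qed
      then have "brw_config x \<omega> (Suc n) = (\<lambda>y. \<Sum>k\<in>K. \<omega> k y)"
        by (simp add: True supp_def)
      then have "pw h (brw_config x \<omega> (Suc n)) = (\<Prod>k\<in>K. pw h (\<omega> k))"
        using \<omega> fin by (simp only:) (rule pw_sum, auto)
      then show ?thesis
        using pw_unit[OF h] by (simp add: prod_ennreal)
    qed (simp add: F_def)
  qed
  also have "\<dots> = (\<integral>\<^sup>+\<omega>. F \<omega> \<partial>\<Omega>) * (\<Prod>k\<in>K. \<integral>\<^sup>+f. ennreal (pw h f) \<partial>\<mu> (fst (snd k)))"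
    by (rule nn_integral_mult_coords) (use fin F in \<open>auto intro!: adapted_upd simp: K_def\<close>)
  also have "(\<Prod>k\<in>K. \<integral>\<^sup>+f. ennreal (pw h f) \<partial>\<mu> (fst (snd k))) = (\<Prod>k\<in>K. ennreal (gen h (fst (snd k))))"
    by (simp add: ennreal_gen[OF h])
  also have "\<dots> = ennreal (\<Prod>k\<in>K. gen h (fst (snd k)))"
    using gen_unit[OF h] by (intro prod_ennreal) (auto simp: unit_fun_def)
  also have "(\<Prod>k\<in>K. gen h (fst (snd k))) = (\<Prod>p\<in>I. gen h (fst p))"
    by (simp add: K_def prod.reindex[OF inj])
  also have "\<dots> = (\<Prod>z\<in>supp g. \<Prod>i<g z. gen h z)"
    unfolding I_def using g by (subst prod.Sigma) (auto intro!: prod.cong)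
  also have "\<dots> = pw (gen h) g"
    by (simp add: pw_def)
  also have "(\<integral>\<^sup>+\<omega>. F \<omega> \<partial>\<Omega>) * ennreal (pw (gen h) g) =
      (\<integral>\<^sup>+\<omega>. F \<omega> * ennreal (pw (gen h) g) \<partial>\<Omega>)"
    by (simp add: nn_integral_multc)
  also have "\<dots> = (\<integral>\<^sup>+\<omega>. F \<omega> * ennreal (pw (gen h) (brw_config x \<omega> n)) \<partial>\<Omega>)"
    by (intro nn_integral_cong) (auto simp: F_def indicator_def)
  finally show ?thesis
    by (simp only: F_def)
qed

lemma nn_integral_partition_config:
  assumes [measurable]: "F \<in> borel_measurable \<Omega>"
  shows "(\<integral>\<^sup>+\<omega>. F \<omega> \<partial>\<Omega>) =
    (\<integral>\<^sup>+g. \<integral>\<^sup>+\<omega>. F \<omega> * indicator {\<omega>. brw_config x \<omega> n = g} \<omega> \<partial>\<Omega> \<partial>count_space {g. finite (supp g)})"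
proof -
  have "(\<integral>\<^sup>+\<omega>. F \<omega> \<partial>\<Omega>) =
      (\<integral>\<^sup>+\<omega>. \<integral>\<^sup>+g. F \<omega> * indicator {\<omega>. brw_config x \<omega> n = g} \<omega> \<partial>count_space {g. finite (supp g)} \<partial>\<Omega>)"
  proof (rule nn_integral_cong_AE, use AE_finite_supp_config[of x n] in eventually_elim)
    fix \<omega> assume fin: "finite (supp (brw_config x \<omega> n))"
    have "(\<integral>\<^sup>+g. F \<omega> * indicator {\<omega>. brw_config x \<omega> n = g} \<omega> \<partial>count_space {g. finite (supp g)}) =
        (\<integral>\<^sup>+g. F \<omega> * indicator {brw_config x \<omega> n} g \<partial>count_space {g. finite (supp g)})"
      by (intro nn_integral_cong) (auto simp: indicator_def)
    also have "\<dots> = F \<omega> * emeasure (count_space {g. finite (supp g)}) {brw_config x \<omega> n}"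
      using fin by (intro nn_integral_cmult_indicator) auto
    also have "\<dots> = F \<omega>"
      using fin by simp
    finally show "F \<omega> = (\<integral>\<^sup>+g. F \<omega> * indicator {\<omega>. brw_config x \<omega> n = g} \<omega> \<partial>count_space {g. finite (supp g)})" ..
  qed
  also have "\<dots> = (\<integral>\<^sup>+g. \<integral>\<^sup>+\<omega>. F \<omega> * indicator {\<omega>. brw_config x \<omega> n = g} \<omega> \<partial>\<Omega> \<partial>count_space {g. finite (supp g)})"
    by (rule nn_integral_count_space_nn_integral[OF countable_finite_supp]) measurable
  finally show ?thesis .
qed

lemma branching_step:
  assumes \<phi>: "adapted n \<phi>" and h: "unit_fun h"
  shows "(\<integral>\<^sup>+\<omega>. \<phi> \<omega> * ennreal (pw h (brw_config x \<omega> (Suc n))) \<partial>\<Omega>) =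
    (\<integral>\<^sup>+\<omega>. \<phi> \<omega> * ennreal (pw (gen h) (brw_config x \<omega> n)) \<partial>\<Omega>)"
proof -
  note [measurable] = adapted_measurable[OF \<phi>]
  have "(\<integral>\<^sup>+\<omega>. \<phi> \<omega> * ennreal (pw h (brw_config x \<omega> (Suc n))) * indicator {\<omega>. brw_config x \<omega> n = g} \<omega> \<partial>\<Omega>) =
    (\<integral>\<^sup>+\<omega>. \<phi> \<omega> * ennreal (pw (gen h) (brw_config x \<omega> n)) * indicator {\<omega>. brw_config x \<omega> n = g} \<omega> \<partial>\<Omega>)"
    if "finite (supp g)" for g
    using branching_step_on[OF \<phi> h that, of x] by (simp only: ac_simps)
  then show ?thesis
    by (subst (1 2) nn_integral_partition_config[where x=x and n=n])
       (measurable, rule nn_integral_cong, simp del: brw_config.simps)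
qed

lemma nn_integral_pw_config:
  assumes "unit_fun h"
  shows "(\<integral>\<^sup>+\<omega>. ennreal (pw h (brw_config x \<omega> n)) \<partial>\<Omega>) = ennreal ((gen ^^ n) h x)"
  using assms
proof (induction n arbitrary: h)
  case 0
  have "pw h (\<lambda>y. if y = x then 1 else 0) = h x"
    by (simp add: pw_def supp_def)
  then show ?case
    by (simp add: P.emeasure_space_1[simplified])
next
  case (Suc n)
  have "(\<integral>\<^sup>+\<omega>. ennreal (pw h (brw_config x \<omega> (Suc n))) \<partial>\<Omega>) =
      (\<integral>\<^sup>+\<omega>. ennreal (pw (gen h) (brw_config x \<omega> n)) \<partial>\<Omega>)"
    using branching_step[of n "\<lambda>_. 1" h x] Suc.prems by (simp del: brw_config.simps add: adapted_def)
  then show ?case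
    using Suc by (simp add: gen_unit funpow_swap1)
qed

end

section \<open>Local extinction probabilities\<close>

lemma of_nat_eq_nn_integral_less:
  "(of_nat m :: ennreal) = (\<integral>\<^sup>+i. indicator {..<m} i \<partial>count_space UNIV)"
  by simp

context brw
begin

text \<open>\<open>avoid y m z\<close> is the probability, starting from \<open>z\<close>, of no visit to \<open>y\<close> in generations \<open>0..m\<close>.\<close>

fun avoid :: "'x \<Rightarrow> nat \<Rightarrow> 'x \<Rightarrow> real" where
  "avoid y 0 = (\<lambda>z. if z = y then 0 else 1)"
| "avoid y (Suc m) = (\<lambda>z. if z = y then 0 else gen (avoid y m) z)"

lemma avoid_unit: "unit_fun (avoid y m)"
  by (induction m) (use gen_unit in \<open>auto simp: unit_fun_def\<close>)

lemma avoid_decreasing: "avoid y (Suc m) z \<le> avoid y m z"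
proof (induction m arbitrary: z)
  case 0
  then show ?case
    using gen_unit[OF avoid_unit[of y 0]] by (simp add: unit_fun_def)
next
  case (Suc m)
  have "gen (avoid y (Suc m)) z \<le> gen (avoid y m) z"
    by (rule gen_mono[OF avoid_unit avoid_unit Suc])
  then show ?case
    by (subst avoid.simps, subst (2) avoid.simps) (simp del: avoid.simps)
qed

lemma sets_avoid [measurable]: "{\<omega>. \<forall>k\<in>{a..b}. brw_config x \<omega> k y = 0} \<in> sets \<Omega>"
proof -
  have "{\<omega> \<in> space \<Omega>. \<forall>k\<in>{a..b}. brw_config x \<omega> k y = 0} \<in> sets \<Omega>"
    by measurable
  then show ?thesis
    by simp
qed

lemma nn_integral_avoid:
  assumes "adapted n \<phi>"
  shows "(\<integral>\<^sup>+\<omega>. \<phi> \<omega> * indicator {\<omega>. \<forall>k\<in>{n..n+m}. brw_config x \<omega> k y = 0} \<omega> \<partial>\<Omega>) =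
    (\<integral>\<^sup>+\<omega>. \<phi> \<omega> * ennreal (pw (avoid y m) (brw_config x \<omega> n)) \<partial>\<Omega>)"
  using assms
proof (induction m arbitrary: n \<phi>)
  case 0
  show ?case
  proof (rule nn_integral_cong_AE, use AE_finite_supp_config[of x n] in eventually_elim)
    fix \<omega> assume "finite (supp (brw_config x \<omega> n))"
    then have "pw (avoid y 0) (brw_config x \<omega> n) = (if brw_config x \<omega> n y = 0 then 1 else 0)"
      using pw_avoid[of "brw_config x \<omega> n" y "\<lambda>_. 1"] by (simp add: pw_def)
    then show "\<phi> \<omega> * indicator {\<omega>. \<forall>k\<in>{n..n+0}. brw_config x \<omega> k y = 0} \<omega> =
        \<phi> \<omega> * ennreal (pw (avoid y 0) (brw_config x \<omega> n))"
      by (simp add: indicator_def)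
  qed
next
  case (Suc m)
  let ?\<psi> = "\<lambda>\<omega>. \<phi> \<omega> * indicator {\<omega>. brw_config x \<omega> n y = 0} \<omega>"
  have \<psi>: "adapted n ?\<psi>"
    by (intro adapted_mult Suc.prems adapted_config[where R="\<lambda>g. g y = 0"]) measurable
  have "{n..n + Suc m} = insert n {Suc n..Suc n + m}"
    by auto
  then have "(\<integral>\<^sup>+\<omega>. \<phi> \<omega> * indicator {\<omega>. \<forall>k\<in>{n..n + Suc m}. brw_config x \<omega> k y = 0} \<omega> \<partial>\<Omega>) =
      (\<integral>\<^sup>+\<omega>. ?\<psi> \<omega> * indicator {\<omega>. \<forall>k\<in>{Suc n..Suc n + m}. brw_config x \<omega> k y = 0} \<omega> \<partial>\<Omega>)"
    by (intro nn_integral_cong) (simp add: indicator_def del: brw_config.simps)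
  also have "\<dots> = (\<integral>\<^sup>+\<omega>. ?\<psi> \<omega> * ennreal (pw (avoid y m) (brw_config x \<omega> (Suc n))) \<partial>\<Omega>)"
    by (rule Suc.IH) (rule adapted_mono[OF \<psi>], simp)
  also have "\<dots> = (\<integral>\<^sup>+\<omega>. ?\<psi> \<omega> * ennreal (pw (gen (avoid y m)) (brw_config x \<omega> n)) \<partial>\<Omega>)"
    by (rule branching_step[OF \<psi> avoid_unit])
  also have "\<dots> = (\<integral>\<^sup>+\<omega>. \<phi> \<omega> * ennreal (pw (avoid y (Suc m)) (brw_config x \<omega> n)) \<partial>\<Omega>)"
  proof (rule nn_integral_cong_AE, use AE_finite_supp_config[of x n] in eventually_elim)
    fix \<omega> assume "finite (supp (brw_config x \<omega> n))"
    then show "?\<psi> \<omega> * ennreal (pw (gen (avoid y m)) (brw_config x \<omega> n)) =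
        \<phi> \<omega> * ennreal (pw (avoid y (Suc m)) (brw_config x \<omega> n))"
      using pw_avoid[of "brw_config x \<omega> n" y "gen (avoid y m)"] by (simp add: indicator_def)
  qed
  finally show ?case .
qed

lemma prob_avoid:
  "P.prob {\<omega>. \<forall>k\<in>{n..n+m}. brw_config x \<omega> k y = 0} = (gen ^^ n) (avoid y m) x"
proof -
  have "emeasure \<Omega> {\<omega>. \<forall>k\<in>{n..n+m}. brw_config x \<omega> k y = 0} =
      (\<integral>\<^sup>+\<omega>. 1 * indicator {\<omega>. \<forall>k\<in>{n..n+m}. brw_config x \<omega> k y = 0} \<omega> \<partial>\<Omega>)"
    by simp
  also have "\<dots> = (\<integral>\<^sup>+\<omega>. 1 * ennreal (pw (avoid y m) (brw_config x \<omega> n)) \<partial>\<Omega>)"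
    by (rule nn_integral_avoid) (simp add: adapted_def)
  also have "\<dots> = ennreal ((gen ^^ n) (avoid y m) x)"
    by (simp add: nn_integral_pw_config avoid_unit)
  finally show ?thesis
    using gen_iter_unit[OF avoid_unit, of n y m] by (simp add: measure_def unit_fun_def)
qed

definition never :: "'x \<Rightarrow> 'x \<Rightarrow> real" where
  "never y z = lim (\<lambda>m. avoid y m z)"

lemma avoid_tendsto: "(\<lambda>m. avoid y m z) \<longlonglongrightarrow> never y z"
proof -
  have "convergent (\<lambda>m. avoid y m z)"
  proof (rule Bseq_monoseq_convergent)
    show "Bseq (\<lambda>m. avoid y m z)"
      by (rule BseqI[of 1]) (use avoid_unit[of y] in \<open>auto simp: unit_fun_def\<close>)
    show "monoseq (\<lambda>m. avoid y m z)"
      using avoid_decreasing by (intro decseq_imp_monoseq decseq_SucI)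
  qed
  then show ?thesis
    by (simp add: never_def convergent_LIMSEQ_iff)
qed

lemma never_unit: "unit_fun (never y)"
  unfolding unit_fun_def
  by (intro allI conjI LIMSEQ_le_const[OF avoid_tendsto] LIMSEQ_le_const2[OF avoid_tendsto])
     (use avoid_unit[of y] in \<open>auto simp: unit_fun_def\<close>)

lemma prob_never: "P.prob {\<omega>. \<forall>k\<ge>n. brw_config x \<omega> k y = 0} = (gen ^^ n) (never y) x"
proof (rule LIMSEQ_unique)
  let ?A = "\<lambda>m. {\<omega>. \<forall>k\<in>{n..n+m}. brw_config x \<omega> k y = 0}"
  have "(\<lambda>m. P.prob (?A m)) \<longlonglongrightarrow> P.prob (\<Inter>m. ?A m)"
    by (rule P.finite_Lim_measure_decseq) (auto simp: decseq_def)
  moreover have "(\<Inter>m. ?A m) = {\<omega>. \<forall>k\<ge>n. brw_config x \<omega> k y = 0}"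
  proof (intro set_eqI iffI)
    fix \<omega> assume \<omega>: "\<omega> \<in> (\<Inter>m. ?A m)"
    have "brw_config x \<omega> k y = 0" if "n \<le> k" for k
    proof -
      have "\<omega> \<in> ?A (k - n)"
        using \<omega> by blast
      then show ?thesis
        using that by simp
    qed
    then show "\<omega> \<in> {\<omega>. \<forall>k\<ge>n. brw_config x \<omega> k y = 0}"
      by simp
  qed simp
  ultimately show "(\<lambda>m. P.prob (?A m)) \<longlonglongrightarrow> P.prob {\<omega>. \<forall>k\<ge>n. brw_config x \<omega> k y = 0}"
    by simp
  show "(\<lambda>m. P.prob (?A m)) \<longlonglongrightarrow> (gen ^^ n) (never y) x"
    unfolding prob_avoid by (intro gen_iter_tendsto avoid_unit avoid_tendsto)
qed

lemma sets_never [measurable]: "{\<omega>. \<forall>k\<ge>n. brw_config x \<omega> k y = 0} \<in> sets \<Omega>"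
proof -
  have "{\<omega> \<in> space \<Omega>. \<forall>k\<ge>n. brw_config x \<omega> k y = 0} \<in> sets \<Omega>"
    by measurable
  then show ?thesis
    by simp
qed

abbreviation "q \<equiv> q_ext \<mu>"

lemma prob_never_tendsto_q: "(\<lambda>n. (gen ^^ n) (never y) x) \<longlonglongrightarrow> q x y"
proof -
  let ?A = "\<lambda>n. {\<omega>. \<forall>k\<ge>n. brw_config x \<omega> k y = 0}"
  have "(\<lambda>n. P.prob (?A n)) \<longlonglongrightarrow> P.prob (\<Union>n. ?A n)"
    by (rule P.finite_Lim_measure_incseq) (auto simp: incseq_def)
  moreover have "(\<Union>n. ?A n) = {\<omega> \<in> space \<Omega>. \<exists>N. \<forall>n\<ge>N. brw_config x \<omega> n y = 0}"
    by auto
  ultimately show ?thesis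
    by (simp add: q_ext_def prob_never)
qed

lemma q_unit: "unit_fun (\<lambda>x. q x y)"
  by (simp add: unit_fun_def q_ext_def)

lemma q_fixpoint: "gen (\<lambda>z. q z y) x = q x y"
proof (rule LIMSEQ_unique)
  show "(\<lambda>n. gen ((gen ^^ n) (never y)) x) \<longlonglongrightarrow> gen (\<lambda>z. q z y) x"
    by (intro gen_tendsto gen_iter_unit never_unit prob_never_tendsto_q)
  show "(\<lambda>n. gen ((gen ^^ n) (never y)) x) \<longlonglongrightarrow> q x y"
    using LIMSEQ_Suc[OF prob_never_tendsto_q[of y x]] by simp
qed

lemma prob_never_le_q: "(gen ^^ n) (never y) x \<le> q x y"
  unfolding prob_never[symmetric] q_ext_def
proof (rule P.finite_measure_mono)
  have "{\<omega> \<in> space \<Omega>. \<exists>N. \<forall>n\<ge>N. brw_config x \<omega> n y = 0} = (\<Union>n. {\<omega>. \<forall>k\<ge>n. brw_config x \<omega> k y = 0})"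
    by auto
  also have "\<dots> \<in> sets \<Omega>"
    by (intro sets.countable_UN) auto
  finally show "{\<omega> \<in> space \<Omega>. \<exists>N. \<forall>n\<ge>N. brw_config x \<omega> n y = 0} \<in> sets \<Omega>" .
qed auto

lemma q_leI:
  assumes "\<And>N. \<exists>n\<ge>N. (gen ^^ n) (avoid y 0) x \<le> c"
  shows "q x y \<le> c"
proof (rule LIMSEQ_le_const2[OF prob_never_tendsto_q])
  have "(gen ^^ N) (never y) x \<le> c" for N
  proof -
    obtain n where n: "N \<le> n" "(gen ^^ n) (avoid y 0) x \<le> c"
      using assms by blast
    have "(gen ^^ N) (never y) x \<le> P.prob {\<omega>. \<forall>k\<in>{n..n+0}. brw_config x \<omega> k y = 0}"
      unfolding prob_never[symmetric] using n(1) by (intro P.finite_measure_mono sets_avoid) auto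
    then show ?thesis
      using n(2) by (simp only: prob_avoid)
  qed
  then show "\<exists>N. \<forall>n\<ge>N. (gen ^^ n) (never y) x \<le> c"
    by blast
qed

lemma nn_integral_config: "(\<integral>\<^sup>+\<omega>. of_nat (brw_config x \<omega> n y) \<partial>\<Omega>) = mom_pow \<mu> n x y"
proof (induction n arbitrary: y)
  case 0
  then show ?case
    by (simp add: P.emeasure_space_1[simplified])
next
  case (Suc n)
  let ?I = "\<lambda>z i \<omega>. indicator {\<omega>. i < brw_config x \<omega> n z} \<omega> :: ennreal"
  have [measurable]: "{\<omega>. i < brw_config x \<omega> n z} \<in> sets \<Omega>" for z i
  proof -
    have "{\<omega> \<in> space \<Omega>. i < brw_config x \<omega> n z} \<in> sets \<Omega>"
      by measurable
    then show ?thesis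
      by simp
  qed
  have m[measurable]: "(\<lambda>\<omega>. (of_nat (\<omega> k y) :: ennreal)) \<in> borel_measurable \<Omega>" for k
    by (rule measurable_coord_borel)
  have m2: "(\<lambda>\<omega>. \<integral>\<^sup>+i. ?I z i \<omega> * of_nat (\<omega> (n, z, i) y) \<partial>count_space UNIV) \<in> borel_measurable \<Omega>" for z
    by (subst nn_integral_count_space_nat) measurable
  have "(\<integral>\<^sup>+\<omega>. of_nat (brw_config x \<omega> (Suc n) y) \<partial>\<Omega>) =
      (\<integral>\<^sup>+\<omega>. \<integral>\<^sup>+z. \<integral>\<^sup>+i. ?I z i \<omega> * of_nat (\<omega> (n, z, i) y) \<partial>count_space UNIV \<partial>count_space UNIV \<partial>\<Omega>)"
  proof (rule nn_integral_cong_AE, use AE_finite_supp_config[of x n] in eventually_elim)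
    fix \<omega> assume fin: "finite (supp (brw_config x \<omega> n))"
    have "(\<integral>\<^sup>+i. ?I z i \<omega> * of_nat (\<omega> (n, z, i) y) \<partial>count_space UNIV) =
        (\<Sum>i<brw_config x \<omega> n z. of_nat (\<omega> (n, z, i) y))" for z
      by (subst nn_integral_count_space'[where A="{..<brw_config x \<omega> n z}"]) (auto simp: indicator_def)
    then have "(\<integral>\<^sup>+z. \<integral>\<^sup>+i. ?I z i \<omega> * of_nat (\<omega> (n, z, i) y) \<partial>count_space UNIV \<partial>count_space UNIV) =
        (\<integral>\<^sup>+z. (\<Sum>i<brw_config x \<omega> n z. of_nat (\<omega> (n, z, i) y)) \<partial>count_space UNIV)"
      by simp
    also have "\<dots> = (\<Sum>z\<in>supp (brw_config x \<omega> n). \<Sum>i<brw_config x \<omega> n z. of_nat (\<omega> (n, z, i) y))"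
      using fin by (subst nn_integral_count_space'[where A="supp (brw_config x \<omega> n)"]) (auto simp: supp_def)
    also have "\<dots> = of_nat (brw_config x \<omega> (Suc n) y)"
      by (simp add: supp_def)
    finally show "of_nat (brw_config x \<omega> (Suc n) y) =
      (\<integral>\<^sup>+z. \<integral>\<^sup>+i. ?I z i \<omega> * of_nat (\<omega> (n, z, i) y) \<partial>count_space UNIV \<partial>count_space UNIV)" ..
  qed
  also have "\<dots> = (\<integral>\<^sup>+z. \<integral>\<^sup>+i. \<integral>\<^sup>+\<omega>. ?I z i \<omega> * of_nat (\<omega> (n, z, i) y) \<partial>\<Omega> \<partial>count_space UNIV \<partial>count_space UNIV)"
    by (subst nn_integral_count_space_nn_integral[OF _ m2])
       (auto intro!: nn_integral_cong nn_integral_count_space_nn_integral)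
  also have "\<dots> = (\<integral>\<^sup>+z. \<integral>\<^sup>+i. (\<integral>\<^sup>+\<omega>. ?I z i \<omega> \<partial>\<Omega>) * mom \<mu> z y \<partial>count_space UNIV \<partial>count_space UNIV)"
  proof (intro nn_integral_cong)
    fix z i
    have "adapted n (?I z i)"
      by (rule adapted_config[where R="\<lambda>g. i < g z"]) measurable
    then show "(\<integral>\<^sup>+\<omega>. ?I z i \<omega> * of_nat (\<omega> (n, z, i) y) \<partial>\<Omega>) = (\<integral>\<^sup>+\<omega>. ?I z i \<omega> \<partial>\<Omega>) * mom \<mu> z y"
      unfolding mom_def
      by (subst nn_integral_mult_coord[where H="\<lambda>f. of_nat (f y)"]) (auto intro: adapted_upd)
  qed
  also have "\<dots> = (\<integral>\<^sup>+z. (\<integral>\<^sup>+\<omega>. of_nat (brw_config x \<omega> n z) \<partial>\<Omega>) * mom \<mu> z y \<partial>count_space UNIV)"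
  proof (intro nn_integral_cong)
    fix z
    have "(\<integral>\<^sup>+i. \<integral>\<^sup>+\<omega>. ?I z i \<omega> \<partial>\<Omega> \<partial>count_space UNIV) =
        (\<integral>\<^sup>+\<omega>. \<integral>\<^sup>+i. ?I z i \<omega> \<partial>count_space UNIV \<partial>\<Omega>)"
      by (rule nn_integral_count_space_nn_integral[symmetric]) auto
    also have "\<dots> = (\<integral>\<^sup>+\<omega>. of_nat (brw_config x \<omega> n z) \<partial>\<Omega>)"
      by (subst of_nat_eq_nn_integral_less) (auto intro!: nn_integral_cong simp: indicator_def simp del: nn_integral_indicator)
    finally show "(\<integral>\<^sup>+i. (\<integral>\<^sup>+\<omega>. ?I z i \<omega> \<partial>\<Omega>) * mom \<mu> z y \<partial>count_space UNIV) =
        (\<integral>\<^sup>+\<omega>. of_nat (brw_config x \<omega> n z) \<partial>\<Omega>) * mom \<mu> z y"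
      by (simp add: nn_integral_multc)
  qed
  also have "\<dots> = mom_pow \<mu> (Suc n) x y"
    by (simp add: Suc)
  finally show ?case .
qed

end

section \<open>First-moment matrix and first passages\<close>

lemma nn_integral_count_space_single:
  "(\<integral>\<^sup>+w. (if w = x then c w else 0) \<partial>count_space UNIV) = (c x :: ennreal)"
  by (subst nn_integral_count_space'[where A="{x}"]) auto

lemma nn_integral_count_space_swap:
  fixes f :: "'a::countable \<Rightarrow> 'b \<Rightarrow> ennreal"
  shows "(\<integral>\<^sup>+x. \<integral>\<^sup>+i. f i x \<partial>count_space UNIV \<partial>count_space UNIV) =
    (\<integral>\<^sup>+i. \<integral>\<^sup>+x. f i x \<partial>count_space UNIV \<partial>count_space UNIV)"
  by (rule nn_integral_count_space_nn_integral) auto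

lemma mom_pow_first_step:
  fixes \<mu> :: "'x::countable \<Rightarrow> ('x \<Rightarrow> nat) pmf"
  shows "mom_pow \<mu> (Suc n) x y = (\<integral>\<^sup>+z. mom \<mu> x z * mom_pow \<mu> n z y \<partial>count_space UNIV)"
proof (induction n arbitrary: y)
  case 0
  have "(\<integral>\<^sup>+z. mom_pow \<mu> 0 x z * mom \<mu> z y \<partial>count_space UNIV) =
      (\<integral>\<^sup>+z. (if z = x then mom \<mu> z y else 0) \<partial>count_space UNIV)"
    by (intro nn_integral_cong) auto
  moreover have "(\<integral>\<^sup>+z. mom \<mu> x z * mom_pow \<mu> 0 z y \<partial>count_space UNIV) =
      (\<integral>\<^sup>+z. (if z = y then mom \<mu> x z else 0) \<partial>count_space UNIV)"
    by (intro nn_integral_cong) auto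
  ultimately show ?case
    by (simp add: nn_integral_count_space_single)
next
  case (Suc n)
  have "mom_pow \<mu> (Suc (Suc n)) x y =
      (\<integral>\<^sup>+w. (\<integral>\<^sup>+z. mom \<mu> x z * mom_pow \<mu> n z w \<partial>count_space UNIV) * mom \<mu> w y \<partial>count_space UNIV)"
    by (subst mom_pow.simps(2)) (simp only: Suc)
  also have "\<dots> = (\<integral>\<^sup>+w. \<integral>\<^sup>+z. mom \<mu> x z * (mom_pow \<mu> n z w * mom \<mu> w y) \<partial>count_space UNIV \<partial>count_space UNIV)"
    by (intro nn_integral_cong, subst nn_integral_multc[symmetric]) (auto simp: ac_simps)
  also have "\<dots> = (\<integral>\<^sup>+z. \<integral>\<^sup>+w. mom \<mu> x z * (mom_pow \<mu> n z w * mom \<mu> w y) \<partial>count_space UNIV \<partial>count_space UNIV)"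
    by (rule nn_integral_count_space_swap)
  also have "\<dots> = (\<integral>\<^sup>+z. mom \<mu> x z * mom_pow \<mu> (Suc n) z y \<partial>count_space UNIV)"
    by (simp add: nn_integral_cmult)
  finally show ?case .
qed

lemma mom_pow_add_ge: "mom_pow \<mu> m x z * mom_pow \<mu> n z y \<le> mom_pow \<mu> (m + n) x y"
proof (induction n arbitrary: y)
  case (Suc n)
  have "mom_pow \<mu> m x z * mom_pow \<mu> (Suc n) z y =
      (\<integral>\<^sup>+w. mom_pow \<mu> m x z * mom_pow \<mu> n z w * mom \<mu> w y \<partial>count_space UNIV)"
    by (simp add: nn_integral_cmult[symmetric] ac_simps)
  also have "\<dots> \<le> (\<integral>\<^sup>+w. mom_pow \<mu> (m + n) x w * mom \<mu> w y \<partial>count_space UNIV)"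
    by (intro nn_integral_mono mult_right_mono Suc) auto
  finally show ?case
    by simp
qed auto

lemma mom_pow_power_le: "mom_pow \<mu> n x x ^ k \<le> mom_pow \<mu> (n * k) x x"
proof (induction k)
  case (Suc k)
  have "mom_pow \<mu> n x x ^ Suc k \<le> mom_pow \<mu> n x x * mom_pow \<mu> (n * k) x x"
    using Suc by (auto intro: mult_left_mono)
  also have "\<dots> \<le> mom_pow \<mu> (n + n * k) x x"
    by (rule mom_pow_add_ge)
  finally show ?case
    by simp
qed simp

lemma enn_root_mono:
  assumes "n > 0" "u \<le> v"
  shows "enn_root n u \<le> enn_root n v"
  using assms
  by (cases u; cases v) (auto simp: enn_root_def top_unique intro!: ennreal_leI)

lemma Ms_gt_1_iff: "Ms \<mu> x x > 1 \<longleftrightarrow> (\<exists>n>0. mom_pow \<mu> n x x > 1)"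
proof
  assume "Ms \<mu> x x > 1"
  show "\<exists>n>0. mom_pow \<mu> n x x > 1"
  proof (rule ccontr)
    assume "\<not> (\<exists>n>0. mom_pow \<mu> n x x > 1)"
    then have "mom_pow \<mu> n x x \<le> 1" if "n > 0" for n
      using that by (meson not_less)
    then have "enn_root n (mom_pow \<mu> n x x) \<le> enn_root n 1" if "n > 0" for n
      using that by (intro enn_root_mono)
    then have "enn_root n (mom_pow \<mu> n x x) \<le> 1" if "n > 0" for n
      using that by (simp add: enn_root_def)
    then have "Ms \<mu> x x \<le> 1"
      unfolding Ms_def by (intro Limsup_bounded) (auto simp: eventually_sequentially intro!: exI[of _ 1])
    then show False
      using \<open>Ms \<mu> x x > 1\<close> by simp
  qed
next
  assume "\<exists>n>0. mom_pow \<mu> n x x > 1"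
  then obtain n where n: "n > 0" "mom_pow \<mu> n x x > 1"
    by blast
  then obtain c where c: "1 < ennreal c" "ennreal c < mom_pow \<mu> n x x" "c \<ge> 0"
    using dense[OF n(2)] by (metis ennreal_cases order.strict_implies_not_eq top.not_eq_extremum not_less_iff_gr_or_eq)
  then have c1: "c > 1"
    by simp
  have le: "ennreal (root n c) \<le> enn_root (n * Suc k) (mom_pow \<mu> (n * Suc k) x x)" for k
  proof -
    have "ennreal (c ^ Suc k) \<le> mom_pow \<mu> n x x ^ Suc k"
      using c by (simp del: power_Suc add: ennreal_power[symmetric] power_mono)
    also have "\<dots> \<le> mom_pow \<mu> (n * Suc k) x x"
      by (rule mom_pow_power_le)
    finally have "enn_root (n * Suc k) (ennreal (c ^ Suc k)) \<le> enn_root (n * Suc k) (mom_pow \<mu> (n * Suc k) x x)"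
      using n(1) by (intro enn_root_mono) auto
    also have "enn_root (n * Suc k) (ennreal (c ^ Suc k)) = ennreal (root n c)"
      using c n(1) by (simp del: power_Suc mult_Suc_right add: enn_root_def real_root_mult_exp real_root_power_cancel)
    finally show ?thesis .
  qed
  have "1 < ennreal (root n c)"
    using n c1 by simp
  also have "\<dots> \<le> liminf (\<lambda>k. enn_root (n * Suc k) (mom_pow \<mu> (n * Suc k) x x))"
    by (intro Liminf_bounded) (use le in auto)
  also have "\<dots> \<le> limsup (\<lambda>k. enn_root (n * Suc k) (mom_pow \<mu> (n * Suc k) x x))"
    by (rule Liminf_le_Limsup) simp
  also have "\<dots> \<le> Ms \<mu> x x"
    using limsup_subseq_mono[of "\<lambda>k. n * Suc k" "\<lambda>n. enn_root n (mom_pow \<mu> n x x)"] n(1)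
    by (simp add: Ms_def strict_mono_def o_def)
  finally show "Ms \<mu> x x > 1" .
qed

definition taboo :: "('x \<Rightarrow> ('x \<Rightarrow> nat) pmf) \<Rightarrow> 'x \<Rightarrow> ('x \<Rightarrow> ennreal) \<Rightarrow> 'x \<Rightarrow> ennreal" where
  "taboo \<mu> x g z = (\<integral>\<^sup>+w. mom \<mu> z w * (if w = x then 0 else g w) \<partial>count_space UNIV)"

text \<open>\<open>fret \<mu> x k z\<close> is the expected number of descendants of a particle at \<open>z\<close> that visit \<open>x\<close> at
  generation \<open>k + 1\<close> and have no ancestor at \<open>x\<close> in generations \<open>1..k\<close>.\<close>

fun fret :: "('x \<Rightarrow> ('x \<Rightarrow> nat) pmf) \<Rightarrow> 'x \<Rightarrow> nat \<Rightarrow> 'x \<Rightarrow> ennreal" where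
  "fret \<mu> x 0 = (\<lambda>z. mom \<mu> z x)"
| "fret \<mu> x (Suc k) = taboo \<mu> x (fret \<mu> x k)"

definition fmom :: "('x \<Rightarrow> ('x \<Rightarrow> nat) pmf) \<Rightarrow> 'x \<Rightarrow> 'x \<Rightarrow> ennreal" where
  "fmom \<mu> x z = (\<Sum>k. fret \<mu> x k z)"

lemma taboo_mono: "(\<And>w. w \<noteq> x \<Longrightarrow> mom \<mu> z w > 0 \<Longrightarrow> g w \<le> g' w) \<Longrightarrow> taboo \<mu> x g z \<le> taboo \<mu> x g' z"
  unfolding taboo_def
proof (intro nn_integral_mono)
  fix w assume "\<And>w. w \<noteq> x \<Longrightarrow> mom \<mu> z w > 0 \<Longrightarrow> g w \<le> g' w"
  then show "mom \<mu> z w * (if w = x then 0 else g w) \<le> mom \<mu> z w * (if w = x then 0 else g' w)"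
    by (cases "mom \<mu> z w = 0") (auto intro!: mult_left_mono simp: zero_less_iff_neq_zero)
qed

lemma taboo_cmult: "taboo \<mu> x (\<lambda>w. c * g w) z = c * taboo \<mu> x g z"
  unfolding taboo_def by (subst nn_integral_cmult[symmetric]) (auto intro!: nn_integral_cong simp: ac_simps)

lemma taboo_multc: "taboo \<mu> x (\<lambda>w. g w * c) z = taboo \<mu> x g z * c"
  using taboo_cmult[of \<mu> x c g z] by (simp add: ac_simps)

lemma taboo_add: "taboo \<mu> x (\<lambda>w. f w + g w) z = taboo \<mu> x f z + taboo \<mu> x g z"
  unfolding taboo_def by (subst nn_integral_add[symmetric]) (auto intro!: nn_integral_cong simp: algebra_simps)

lemma taboo_sum: "taboo \<mu> x (\<lambda>w. \<Sum>k\<in>K. g k w) z = (\<Sum>k\<in>K. taboo \<mu> x (g k) z)"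
  unfolding taboo_def by (subst nn_integral_sum[symmetric]) (auto intro!: nn_integral_cong simp: sum_distrib_left)

lemma taboo_suminf: "taboo \<mu> x (\<lambda>w. \<Sum>k. g k w) z = (\<Sum>k. taboo \<mu> x (g k) z)"
  unfolding taboo_def by (subst nn_integral_suminf[symmetric]) (auto intro!: nn_integral_cong)

lemma nn_integral_mom_split:
  "(\<integral>\<^sup>+w. mom \<mu> z w * g w \<partial>count_space UNIV) = mom \<mu> z x * g x + taboo \<mu> x g z"
proof -
  have "(\<integral>\<^sup>+w. mom \<mu> z w * g w \<partial>count_space UNIV) =
      (\<integral>\<^sup>+w. (if w = x then mom \<mu> z w * g w else 0) + mom \<mu> z w * (if w = x then 0 else g w) \<partial>count_space UNIV)"
    by (intro nn_integral_cong) auto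
  also have "\<dots> = mom \<mu> z x * g x + taboo \<mu> x g z"
    by (subst nn_integral_add) (auto simp: nn_integral_count_space_single taboo_def)
  finally show ?thesis .
qed

lemma fret_tail: "(\<Sum>k. fret \<mu> x (k + n) z) = fret \<mu> x n z + (\<Sum>k. fret \<mu> x (k + Suc n) z)"
  using suminf_offset[of "\<lambda>k. fret \<mu> x (k + n) z" 1] by (simp add: ac_simps)

lemma fmom_eq: "fmom \<mu> x z = mom \<mu> z x + taboo \<mu> x (fmom \<mu> x) z"
proof -
  have eq: "fmom \<mu> x = (\<lambda>w. \<Sum>k. fret \<mu> x k w)"
    by (simp add: fmom_def fun_eq_iff)
  show ?thesis
    unfolding eq taboo_suminf using fret_tail[of \<mu> x 0 z] by simp
qed

lemma renewal:
  fixes \<mu> :: "'x::countable \<Rightarrow> ('x \<Rightarrow> nat) pmf"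
  shows "(\<Sum>k\<le>n. fret \<mu> x k z * mom_pow \<mu> (n - k) x x) \<le> mom_pow \<mu> (Suc n) z x"
proof (induction n arbitrary: z)
  case 0
  then show ?case
    by (simp add: mom_pow_first_step nn_integral_mom_split[where x=x] del: mom_pow.simps(2))
next
  case (Suc n)
  have "(\<Sum>k\<le>Suc n. fret \<mu> x k z * mom_pow \<mu> (Suc n - k) x x) =
      mom \<mu> z x * mom_pow \<mu> (Suc n) x x + (\<Sum>k\<le>n. taboo \<mu> x (fret \<mu> x k) z * mom_pow \<mu> (n - k) x x)"
    by (subst sum.atMost_Suc_shift) simp
  also have "\<dots> = mom \<mu> z x * mom_pow \<mu> (Suc n) x x
      + taboo \<mu> x (\<lambda>w. \<Sum>k\<le>n. fret \<mu> x k w * mom_pow \<mu> (n - k) x x) z"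
    by (simp only: taboo_sum taboo_multc)
  also have "\<dots> \<le> mom \<mu> z x * mom_pow \<mu> (Suc n) x x + taboo \<mu> x (\<lambda>w. mom_pow \<mu> (Suc n) w x) z"
    by (intro add_left_mono taboo_mono Suc)
  also have "\<dots> = mom_pow \<mu> (Suc (Suc n)) z x"
    by (subst (3) mom_pow_first_step) (simp only: nn_integral_mom_split[where x=x])
  finally show ?case .
qed

lemma fmom_le_1:
  fixes \<mu> :: "'x::countable \<Rightarrow> ('x \<Rightarrow> nat) pmf"
  assumes "\<not> Ms \<mu> x x > 1"
  shows "fmom \<mu> x x \<le> 1"
proof (rule ccontr)
  assume "\<not> fmom \<mu> x x \<le> 1"
  then obtain K where K: "1 < (\<Sum>k<K. fret \<mu> x k x)"
    by (auto simp: fmom_def suminf_eq_SUP less_SUP_iff not_le)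
  then obtain r where r: "1 < ennreal r" "ennreal r < (\<Sum>k<K. fret \<mu> x k x)" "r \<ge> 0"
    using dense[OF K] by (metis ennreal_cases order.strict_implies_not_eq top.not_eq_extremum not_less_iff_gr_or_eq)
  have "K > 0"
    using K by (cases K) auto
  have "r > 1"
    using r by simp
  define l where "l = root K (1 / r)"
  have l: "0 < l" "l < 1" "l ^ K * r = 1"
    using \<open>r > 1\<close> \<open>K > 0\<close> by (auto simp: l_def)
  define b where "b = (\<lambda>n. mom_pow \<mu> n x x)"
  define c where "c = (\<lambda>n. b n * ennreal (l ^ n))"
  have b: "b n \<le> 1" for n
    using assms unfolding Ms_gt_1_iff b_def by (cases "n = 0") (simp, meson not_less zero_less_iff_neq_zero)
  have "b n * ennreal (l ^ n) \<le> 1 * ennreal (l ^ n)" for n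
    by (rule mult_right_mono[OF b]) simp
  then have "(\<Sum>n. c n) \<le> (\<Sum>n. ennreal (l ^ n))"
    unfolding c_def by (intro suminf_le) auto
  also have "\<dots> = ennreal (\<Sum>n. l ^ n)"
    using l by (intro suminf_ennreal2) auto
  also have "\<dots> < \<top>"
    by simp
  finally have fin: "(\<Sum>n. c n) < \<top>" .
  have shift: "(\<Sum>n. if k \<le> n then c (n - k) else 0) = (\<Sum>n. c n)" for k
    using suminf_offset[of "\<lambda>n. if k \<le> n then c (n - k) else 0" k] by simp
  have "ennreal (l ^ K) * (\<Sum>k<K. fret \<mu> x k x) * (\<Sum>n. c n) =
      (\<Sum>k<K. ennreal (l ^ K) * fret \<mu> x k x * (\<Sum>n. if k \<le> n then c (n - k) else 0))"
    by (simp add: shift sum_distrib_left sum_distrib_right)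
  also have "\<dots> = (\<Sum>n. \<Sum>k<K. ennreal (l ^ K) * fret \<mu> x k x * (if k \<le> n then c (n - k) else 0))"
    by (subst suminf_sum) auto
  also have "\<dots> \<le> (\<Sum>n. c (Suc n))"
  proof (intro suminf_le)
    fix n
    have "(\<Sum>k<K. ennreal (l ^ K) * fret \<mu> x k x * (if k \<le> n then c (n - k) else 0)) =
        (\<Sum>k\<in>{..<K} \<inter> {..n}. ennreal (l ^ K) * fret \<mu> x k x * c (n - k))"
      by (subst sum.inter_restrict) (auto intro!: sum.cong)
    also have "\<dots> \<le> (\<Sum>k\<in>{..<K} \<inter> {..n}. ennreal (l ^ Suc n) * (fret \<mu> x k x * b (n - k)))"
    proof (intro sum_mono)
      fix k assume k: "k \<in> {..<K} \<inter> {..n}"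
      have "l ^ K * l ^ (n - k) = l ^ (K + (n - k))"
        by (simp add: power_add)
      also have "\<dots> \<le> l ^ Suc n"
        using k l by (intro power_decreasing) auto
      finally have "ennreal (l ^ K) * ennreal (l ^ (n - k)) \<le> ennreal (l ^ Suc n)"
        using l by (subst ennreal_mult[symmetric]) (auto intro: ennreal_leI)
      then have "(ennreal (l ^ K) * ennreal (l ^ (n - k))) * (fret \<mu> x k x * b (n - k)) \<le>
          ennreal (l ^ Suc n) * (fret \<mu> x k x * b (n - k))"
        by (rule mult_right_mono) simp
      then show "ennreal (l ^ K) * fret \<mu> x k x * c (n - k) \<le> ennreal (l ^ Suc n) * (fret \<mu> x k x * b (n - k))"
        by (simp add: c_def ac_simps)
    qed
    also have "\<dots> \<le> (\<Sum>k\<le>n. ennreal (l ^ Suc n) * (fret \<mu> x k x * b (n - k)))"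
      by (intro sum_mono2) auto
    also have "\<dots> = ennreal (l ^ Suc n) * (\<Sum>k\<le>n. fret \<mu> x k x * b (n - k))"
      by (simp only: sum_distrib_left)
    also have "\<dots> \<le> c (Suc n)"
      using renewal[of \<mu> x x n] by (simp del: mom_pow.simps power_Suc add: c_def b_def ac_simps mult_right_mono mult_left_mono)
    finally show "(\<Sum>k<K. ennreal (l ^ K) * fret \<mu> x k x * (if k \<le> n then c (n - k) else 0)) \<le> c (Suc n)" .
  qed auto
  finally have 1: "ennreal (l ^ K) * (\<Sum>k<K. fret \<mu> x k x) * (\<Sum>n. c n) \<le> (\<Sum>n. c (Suc n))" .
  have "1 = ennreal (l ^ K) * ennreal r"
    using l r by (subst ennreal_mult[symmetric]) auto
  also have "\<dots> \<le> ennreal (l ^ K) * (\<Sum>k<K. fret \<mu> x k x)"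
    using r by (intro mult_left_mono) auto
  finally have "1 * (\<Sum>n. c n) \<le> ennreal (l ^ K) * (\<Sum>k<K. fret \<mu> x k x) * (\<Sum>n. c n)"
    by (intro mult_right_mono) auto
  with 1 have "(\<Sum>n. c n) \<le> (\<Sum>n. c (Suc n))"
    by simp
  moreover have "(\<Sum>n. c n) = (\<Sum>n. c (Suc n)) + 1"
    using suminf_offset[of c 1] by (simp add: c_def b_def)
  ultimately show False
    using fin by (cases "\<Sum>n. c (Suc n)") (auto simp: ennreal_add_eq_top simp flip: ennreal_1 ennreal_plus)
qed

section \<open>Fixed points of the generating functional\<close>

lemma nn_integral_eq_imp_AE_eq:
  fixes f g :: "'a \<Rightarrow> ennreal"
  assumes [measurable]: "f \<in> borel_measurable M" "g \<in> borel_measurable M"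
    and le: "AE x in M. f x \<le> g x" and int: "(\<integral>\<^sup>+x. g x \<partial>M) \<le> (\<integral>\<^sup>+x. f x \<partial>M)"
    and fin: "(\<integral>\<^sup>+x. f x \<partial>M) < \<top>"
  shows "AE x in M. f x = g x"
proof -
  have "(\<integral>\<^sup>+x. g x - f x \<partial>M) = (\<integral>\<^sup>+x. g x \<partial>M) - (\<integral>\<^sup>+x. f x \<partial>M)"
    using fin le by (intro nn_integral_diff) auto
  also have "\<dots> = 0"
    using int fin by (simp add: diff_eq_0_iff_ennreal less_top)
  finally have "AE x in M. g x - f x = 0"
    by (subst (asm) nn_integral_0_iff_AE) auto
  then show ?thesis
    using le
  proof eventually_elim
    fix x assume "g x - f x = 0" "f x \<le> g x"
    then show "f x = g x"
      by (metis diff_eq_0_iff_ennreal order.antisym less_imp_le order_refl)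
  qed
qed

lemma pw_remove:
  assumes "finite (supp f)" "f w \<noteq> 0"
  shows "pw h f = h w * pw h (\<lambda>z. if z = w then f w - 1 else f z)"
proof -
  let ?d = "\<lambda>z. if z = w then 1 else 0 :: nat" and ?f = "\<lambda>z. if z = w then f w - 1 else f z"
  have "f = (\<lambda>z. ?d z + ?f z)"
    using assms(2) by auto
  then have "pw h f = pw h (\<lambda>z. ?d z + ?f z)"
    by (rule arg_cong)
  also have "\<dots> = pw h ?d * pw h ?f"
  proof (rule pw_add)
    show "finite (supp ?d)"
      by (simp add: supp_def)
    show "finite (supp ?f)"
      by (rule finite_subset[OF _ assms(1)]) (auto simp: supp_def split: if_splits)
  qed
  also have "pw h ?d = h w"
    by (simp add: pw_def supp_def)
  finally show ?thesis .
qed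

lemma one_minus_prod_le:
  fixes a :: "'i \<Rightarrow> real"
  assumes "finite I" "\<And>i. i \<in> I \<Longrightarrow> 0 \<le> a i \<and> a i \<le> 1"
  shows "1 - (\<Prod>i\<in>I. a i) \<le> (\<Sum>i\<in>I. 1 - a i)"
  using assms
proof (induction I rule: finite_induct)
  case (insert j I)
  let ?P = "\<Prod>i\<in>I. a i"
  have "?P \<le> 1"
    using insert.prems by (intro prod_le_1) auto
  then have "0 \<le> (1 - a j) * (1 - ?P)"
    using insert.prems by auto
  then have "1 - a j * ?P \<le> (1 - a j) + (1 - ?P)"
    by (simp add: algebra_simps)
  then show ?case
    using insert by auto
qed simp

lemma one_minus_pw_le:
  assumes h: "unit_fun h"
  shows "1 - pw h f \<le> (\<Sum>z\<in>supp f. real (f z) * (1 - h z))"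
proof (cases "finite (supp f)")
  case True
  have "1 - pw h f \<le> (\<Sum>z\<in>supp f. 1 - h z ^ f z)"
    unfolding pw_def using True h by (intro one_minus_prod_le) (auto simp: unit_fun_def power_le_one)
  also have "\<dots> \<le> (\<Sum>z\<in>supp f. real (f z) * (1 - h z))"
  proof (intro sum_mono)
    fix z
    have "1 + real (f z) * (h z - 1) \<le> (1 + (h z - 1)) ^ f z"
      using h by (intro Bernoulli_inequality) (auto simp: unit_fun_def)
    then show "1 - h z ^ f z \<le> real (f z) * (1 - h z)"
      by (simp add: algebra_simps)
  qed
  finally show ?thesis .
qed (simp add: pw_infinite)

lemma pw_eq_1_imp:
  assumes h: "unit_fun h" and f: "finite (supp f)" and "pw h f = 1" "f z \<noteq> 0"
  shows "h z = 1"
proof -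
  have "pw h f \<le> h z * 1"
    unfolding pw_remove[OF f \<open>f z \<noteq> 0\<close>] using h
    by (intro mult_left_mono pw_le_1) (auto simp: unit_fun_def)
  then show ?thesis
    using h assms(3) by (auto simp: unit_fun_def intro: antisym)
qed

text \<open>Removing one particle at a site with \<open>h < 1\<close>, equality forces the product over the
  remaining particles to be 1.\<close>

lemma one_minus_pw_eq_imp:
  assumes h: "unit_fun h" and f: "finite (supp f)"
    and eq: "1 - pw h f = (\<Sum>z\<in>supp f. real (f z) * (1 - h z))"
  shows "(\<Sum>z\<in>{z \<in> supp f. h z < 1}. f z) \<le> 1"
proof (cases "{z \<in> supp f. h z < 1} = {}")
  case False
  then obtain w where w: "f w \<noteq> 0" "h w < 1"
    by (auto simp: supp_def)
  define f' where "f' = (\<lambda>z. if z = w then f w - 1 else f z)"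
  have sub: "supp f' \<subseteq> supp f"
    by (auto simp: supp_def f'_def split: if_splits)
  then have f': "finite (supp f')"
    using f finite_subset by blast
  have "(\<Sum>z\<in>supp f. real (f z) * (1 - h z)) =
      (\<Sum>z\<in>supp f. (if z = w then 1 - h w else 0) + real (f' z) * (1 - h z))"
    using w by (intro sum.cong) (auto simp: f'_def algebra_simps)
  also have "\<dots> = (1 - h w) + (\<Sum>z\<in>supp f. real (f' z) * (1 - h z))"
    using w f by (simp add: sum.distrib supp_def)
  also have "(\<Sum>z\<in>supp f. real (f' z) * (1 - h z)) = (\<Sum>z\<in>supp f'. real (f' z) * (1 - h z))"
    using sub f by (intro sum.mono_neutral_right) (auto simp: supp_def)
  finally have "1 - h w * pw h f' \<ge> (1 - h w) + (1 - pw h f')"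
    using one_minus_pw_le[OF h, of f'] eq pw_remove[OF f w(1), of h] by (simp add: f'_def)
  then have "(1 - h w) * (1 - pw h f') \<le> 0"
    by (simp add: algebra_simps)
  then have "pw h f' \<ge> 1"
    using w(2) by (simp add: mult_le_0_iff)
  moreover have "pw h f' \<le> 1"
    using h by (intro pw_le_1) (auto simp: unit_fun_def)
  ultimately have "pw h f' = 1"
    by simp
  then have *: "h z = 1" if "f' z \<noteq> 0" for z
    using pw_eq_1_imp[OF h f'] that by blast
  have "f w = 1"
  proof (rule ccontr)
    assume "f w \<noteq> 1"
    then have "f' w \<noteq> 0"
      using w by (simp add: f'_def)
    then show False
      using *[of w] w by simp
  qed
  moreover have "z = w" if "f z \<noteq> 0" "h z < 1" for z
    using *[of z] that unfolding f'_def by (cases "z = w") auto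
  ultimately have "{z \<in> supp f. h z < 1} = {w}" "f w = 1"
    using w by (auto simp: supp_def)
  then show ?thesis
    by simp
qed (simp only: sum.empty)

lemma mom_pos_iff: "mom \<mu> z w > 0 \<longleftrightarrow> (\<exists>f\<in>set_pmf (\<mu> z). f w \<noteq> 0)"
proof -
  have "mom \<mu> z w = 0 \<longleftrightarrow> (\<forall>f\<in>set_pmf (\<mu> z). f w = 0)"
    unfolding mom_def by (subst nn_integral_0_iff_AE) (auto simp: AE_measure_pmf_iff)
  then show ?thesis
    unfolding zero_less_iff_neq_zero by simp
qed

lemma mom_le_nn_integral: "mom \<mu> z w * g w \<le> (\<integral>\<^sup>+w. mom \<mu> z w * g w \<partial>count_space UNIV)"
  by (rule nn_integral_ge_point) simp

lemma nn_integral_mom_mono: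
  assumes "\<And>w. mom \<mu> z w > 0 \<Longrightarrow> g w \<le> g' w"
  shows "(\<integral>\<^sup>+w. mom \<mu> z w * g w \<partial>count_space UNIV) \<le> (\<integral>\<^sup>+w. mom \<mu> z w * g' w \<partial>count_space UNIV)"
proof (intro nn_integral_mono)
  fix w
  show "mom \<mu> z w * g w \<le> mom \<mu> z w * g' w"
    using assms by (cases "mom \<mu> z w = 0") (auto intro!: mult_left_mono simp: zero_less_iff_neq_zero)
qed

lemma nn_integral_mom_eq_imp:
  assumes le: "\<And>w. mom \<mu> z w > 0 \<Longrightarrow> g w \<le> g' w"
    and eq: "(\<integral>\<^sup>+w. mom \<mu> z w * g' w \<partial>count_space UNIV) \<le> (\<integral>\<^sup>+w. mom \<mu> z w * g w \<partial>count_space UNIV)"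
    and fin: "(\<integral>\<^sup>+w. mom \<mu> z w * g w \<partial>count_space UNIV) < \<top>"
    and pos: "mom \<mu> z w > 0"
  shows "g w = g' w"
proof (cases "g' w = 0")
  case False
  have "AE w in count_space UNIV. mom \<mu> z w * g w = mom \<mu> z w * g' w"
  proof (rule nn_integral_eq_imp_AE_eq[OF _ _ _ eq fin])
    have "mom \<mu> z w * g w \<le> mom \<mu> z w * g' w" for w
      using le[of w] by (cases "mom \<mu> z w = 0") (auto intro!: mult_left_mono simp: zero_less_iff_neq_zero)
    then show "AE w in count_space UNIV. mom \<mu> z w * g w \<le> mom \<mu> z w * g' w"
      by simp
  qed auto
  then have *: "mom \<mu> z w * g w = mom \<mu> z w * g' w"
    by (simp add: AE_count_space)
  have "mom \<mu> z w * g' w < \<top>"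
    using mom_le_nn_integral[of \<mu> z w g] fin unfolding * by (rule le_less_trans)
  then have "mom \<mu> z w < \<top>"
    using False by (metis ennreal_top_mult top.not_eq_extremum)
  then show ?thesis
    using * pos by (auto simp: ennreal_mult_cancel_left)
qed (use le[OF pos] in simp)

lemma taboo_ge: "w \<noteq> x \<Longrightarrow> mom \<mu> z w * g w \<le> taboo \<mu> x g z"
  unfolding taboo_def using nn_integral_ge_point[of w UNIV "\<lambda>w. mom \<mu> z w * (if w = x then 0 else g w)"]
  by simp

lemma fmom_pos:
  assumes "mom \<mu> z w > 0" "w = x \<or> fmom \<mu> x w > 0"
  shows "fmom \<mu> x z > 0"
proof (cases "w = x")
  case True
  then show ?thesis
    using assms(1) by (subst fmom_eq) (simp add: add_pos_nonneg)
next
  case False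
  then have "0 < mom \<mu> z w * fmom \<mu> x w"
    using assms by (simp add: ennreal_zero_less_mult_iff)
  also have "\<dots> \<le> fmom \<mu> x z"
    using taboo_ge[OF False, of \<mu> z "fmom \<mu> x"] by (subst (2) fmom_eq) (simp add: add_increasing)
  finally show ?thesis .
qed

lemma fret_pos_imp_reach: "fret \<mu> x k z > 0 \<Longrightarrow> reach \<mu> z x"
proof (induction k arbitrary: z)
  case 0
  then show ?case
    by (auto simp: reach_def)
next
  case (Suc k)
  have "\<exists>w. mom \<mu> z w > 0 \<and> fret \<mu> x k w > 0"
  proof (rule ccontr)
    assume "\<not> ?thesis"
    then have zero: "mom \<mu> z w * (if w = x then 0 else fret \<mu> x k w) = 0" for w
      by (auto simp: zero_less_iff_neq_zero)
    have "taboo \<mu> x (fret \<mu> x k) z = 0"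
      unfolding taboo_def zero by simp
    then show False
      using Suc.prems by simp
  qed
  then obtain w where w: "mom \<mu> z w > 0" "reach \<mu> w x"
    using Suc.IH by auto
  then show ?case
    unfolding reach_def by (rule converse_rtranclp_into_rtranclp)
qed

lemma fmom_pos_imp_reach: "fmom \<mu> x z > 0 \<Longrightarrow> reach \<mu> z x"
proof (rule ccontr)
  assume "fmom \<mu> x z > 0" "\<not> reach \<mu> z x"
  then have "fret \<mu> x k z = 0" for k
    using fret_pos_imp_reach[of \<mu> x k z] not_gr_zero by blast
  then show False
    using \<open>fmom \<mu> x z > 0\<close> by (simp add: fmom_def)
qed

lemma reach_refl: "reach \<mu> x x"
  by (simp add: reach_def)

lemma reach_trans: "reach \<mu> x y \<Longrightarrow> reach \<mu> y z \<Longrightarrow> reach \<mu> x z"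
  by (simp add: reach_def)

lemma reach_step: "reach \<mu> x y \<Longrightarrow> mom \<mu> y z > 0 \<Longrightarrow> reach \<mu> x z"
  by (simp add: reach_def rtranclp.rtrancl_into_rtrancl)

lemma offspring_eq_sum:
  assumes "finite (supp f)" "\<And>z. 0 \<le> v z"
  shows "(\<integral>\<^sup>+w. of_nat (f w) * ennreal (v w) \<partial>count_space UNIV) = ennreal (\<Sum>w\<in>supp f. real (f w) * v w)"
proof -
  have "(\<integral>\<^sup>+w. of_nat (f w) * ennreal (v w) \<partial>count_space UNIV) = (\<Sum>w\<in>supp f. of_nat (f w) * ennreal (v w))"
    using assms(1) by (intro nn_integral_count_space') (auto simp: supp_def)
  also have "\<dots> = (\<Sum>w\<in>supp f. ennreal (real (f w) * v w))"
    using assms(2) by (simp add: ennreal_mult ennreal_of_nat_eq_real_of_nat)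
  also have "\<dots> = ennreal (\<Sum>w\<in>supp f. real (f w) * v w)"
    using assms(2) by simp
  finally show ?thesis .
qed

context brw
begin

lemma nn_integral_offspring:
  "(\<integral>\<^sup>+w. mom \<mu> z w * g w \<partial>count_space UNIV) =
    (\<integral>\<^sup>+f. \<integral>\<^sup>+w. of_nat (f w) * g w \<partial>count_space UNIV \<partial>measure_pmf (\<mu> z))"
  unfolding mom_def
  by (subst nn_integral_count_space_nn_integral) (auto simp: nn_integral_multc)

lemma ennreal_one_minus_gen:
  assumes h: "unit_fun h"
  shows "ennreal (1 - gen h z) = (\<integral>\<^sup>+f. ennreal (1 - pw h f) \<partial>measure_pmf (\<mu> z))"
proof -
  have "1 - gen h z = (\<integral>f. 1 - pw h f \<partial>measure_pmf (\<mu> z))"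
    unfolding gen_def by (subst Bochner_Integration.integral_diff) (auto intro: integrable_pw h)
  then show ?thesis
    using pw_unit[OF h]
    by (subst nn_integral_eq_integral)
       (auto intro!: Bochner_Integration.integrable_diff[of _ "\<lambda>_. 1"] integrable_pw[OF h])
qed

lemma one_minus_pw_le_offspring:
  assumes h: "unit_fun h" and f: "f \<in> set_pmf (\<mu> z)"
  shows "ennreal (1 - pw h f) \<le> (\<integral>\<^sup>+w. of_nat (f w) * ennreal (1 - h w) \<partial>count_space UNIV)"
  using h by (subst offspring_eq_sum[OF fin_supp[OF f]])
    (auto simp: unit_fun_def intro!: ennreal_leI one_minus_pw_le)

lemma one_minus_gen_le:
  assumes h: "unit_fun h"
  shows "ennreal (1 - gen h z) \<le> (\<integral>\<^sup>+w. mom \<mu> z w * ennreal (1 - h w) \<partial>count_space UNIV)"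
  unfolding ennreal_one_minus_gen[OF h] nn_integral_offspring
  by (intro nn_integral_mono_AE) (auto simp: AE_measure_pmf_iff one_minus_pw_le_offspring[OF h])

lemma one_minus_gen_eq_imp:
  assumes h: "unit_fun h"
    and eq: "(\<integral>\<^sup>+w. mom \<mu> z w * ennreal (1 - h w) \<partial>count_space UNIV) \<le> ennreal (1 - gen h z)"
    and f: "f \<in> set_pmf (\<mu> z)"
  shows "(\<Sum>w\<in>{w \<in> supp f. h w < 1}. f w) \<le> 1"
proof (rule one_minus_pw_eq_imp[OF h fin_supp[OF f]])
  have h': "0 \<le> 1 - h w" for w
    using h by (simp add: unit_fun_def)
  have "AE f in measure_pmf (\<mu> z). ennreal (1 - pw h f) = (\<integral>\<^sup>+w. of_nat (f w) * ennreal (1 - h w) \<partial>count_space UNIV)"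
    using eq unfolding ennreal_one_minus_gen[OF h] nn_integral_offspring
    by (intro nn_integral_eq_imp_AE_eq)
       (auto simp: AE_measure_pmf_iff one_minus_pw_le_offspring[OF h] simp flip: ennreal_one_minus_gen[OF h])
  then have "ennreal (1 - pw h f) = ennreal (\<Sum>w\<in>supp f. real (f w) * (1 - h w))"
    using f h' fin_supp[OF f] by (simp add: AE_measure_pmf_iff offspring_eq_sum)
  then show "1 - pw h f = (\<Sum>w\<in>supp f. real (f w) * (1 - h w))"
    using pw_unit[OF h, of f] h' by (subst (asm) ennreal_inj) (auto intro: sum_nonneg)
qed

lemma gen_less_1:
  assumes h: "unit_fun h" and "mom \<mu> a b > 0" "h b < 1"
  shows "gen h a < 1"
proof (rule ccontr)
  assume "\<not> gen h a < 1"
  then have "ennreal (1 - gen h a) = 0"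
    by (simp add: ennreal_eq_0_iff)
  then have "AE f in measure_pmf (\<mu> a). ennreal (1 - pw h f) = 0"
    unfolding ennreal_one_minus_gen[OF h] by (subst (asm) nn_integral_0_iff_AE) auto
  then have *: "pw h f = 1" if "f \<in> set_pmf (\<mu> a)" for f
    using that pw_unit[OF h, of f] by (auto simp: AE_measure_pmf_iff ennreal_eq_0_iff intro: antisym)
  obtain f where f: "f \<in> set_pmf (\<mu> a)" "f b \<noteq> 0"
    using assms(2) by (auto simp: mom_pos_iff)
  then show False
    using pw_eq_1_imp[OF h fin_supp[OF f(1)] *[OF f(1)] f(2)] assms(3) by simp
qed

lemma reach_gen_iter_less_1:
  assumes "reach \<mu> a b"
  shows "\<exists>n. \<forall>h. unit_fun h \<longrightarrow> h b < 1 \<longrightarrow> (gen ^^ n) h a < 1"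
  using assms unfolding reach_def
proof (induction rule: converse_rtranclp_induct)
  case base
  show ?case
    by (rule exI[of _ 0]) simp
next
  case (step a c)
  then obtain n where n: "\<And>h. unit_fun h \<Longrightarrow> h b < 1 \<Longrightarrow> (gen ^^ n) h c < 1"
    by blast
  have "(gen ^^ Suc n) h a < 1" if "unit_fun h" "h b < 1" for h
    using gen_less_1[OF gen_iter_unit[OF that(1)] step(1) n[OF that]] by simp
  then show ?case
    by blast
qed

lemma one_minus_gen_avoid_le: "ennreal (1 - gen (avoid y m) z) \<le> fmom \<mu> y z"
proof (induction m arbitrary: z)
  have step: "ennreal (1 - gen (avoid y m) z) \<le> fmom \<mu> y z"
    if "\<And>w. w \<noteq> y \<Longrightarrow> ennreal (1 - avoid y m w) \<le> fmom \<mu> y w" for m z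
  proof -
    have "avoid y m y = 0"
      by (cases m) auto
    then have "ennreal (1 - gen (avoid y m) z) \<le> mom \<mu> z y + taboo \<mu> y (\<lambda>w. ennreal (1 - avoid y m w)) z"
      using one_minus_gen_le[OF avoid_unit, of y m z] by (simp add: nn_integral_mom_split[where x=y])
    also have "\<dots> \<le> mom \<mu> z y + taboo \<mu> y (fmom \<mu> y) z"
      by (intro add_left_mono taboo_mono that)
    finally show ?thesis
      by (simp only: fmom_eq[symmetric])
  qed
  case 0
  show ?case
    by (rule step) simp
  case (Suc m)
  show ?case
    by (rule step) (simp add: Suc)
qed

lemma one_minus_q_le_fmom: "ennreal (1 - q z y) \<le> fmom \<mu> y z"
proof -
  have "(\<lambda>m. ennreal (1 - gen (avoid y m) z)) \<longlonglongrightarrow> ennreal (1 - gen (never y) z)"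
    by (intro tendsto_intros tendsto_ennrealI gen_tendsto avoid_unit avoid_tendsto)
  then have "ennreal (1 - gen (never y) z) \<le> fmom \<mu> y z"
    by (rule LIMSEQ_le_const2) (auto simp: one_minus_gen_avoid_le)
  moreover have "ennreal (1 - q z y) \<le> ennreal (1 - gen (never y) z)"
    using prob_never_le_q[of 1 y z] by (intro ennreal_leI) simp
  ultimately show ?thesis
    by (rule order_trans[rotated])
qed

end

lemma fret_tail_tendsto_0:
  assumes "fmom \<mu> x z < \<top>"
  shows "(\<lambda>n. \<Sum>k. fret \<mu> x (k + n) z) \<longlonglongrightarrow> 0"
proof -
  have "(\<lambda>n. fmom \<mu> x z - (\<Sum>k<n. fret \<mu> x k z)) \<longlonglongrightarrow> fmom \<mu> x z - fmom \<mu> x z"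
    using assms unfolding fmom_def
    by (intro tendsto_diff_ennreal tendsto_const summable_LIMSEQ) auto
  moreover have "fmom \<mu> x z - (\<Sum>k<n. fret \<mu> x k z) = (\<Sum>k. fret \<mu> x (k + n) z)" for n
  proof -
    have eq: "fmom \<mu> x z = (\<Sum>k. fret \<mu> x (k + n) z) + (\<Sum>k<n. fret \<mu> x k z)"
      unfolding fmom_def by (rule suminf_offset) simp
    have "(\<Sum>k<n. fret \<mu> x k z) \<le> fmom \<mu> x z"
      unfolding fmom_def by (rule sum_le_suminf) auto
    then have "(\<Sum>k<n. fret \<mu> x k z) < \<top>"
      using assms by (rule le_less_trans)
    then show ?thesis
      unfolding eq by (intro ennreal_add_diff_cancel_right less_imp_neq)
  qed
  ultimately show ?thesis
    using assms by simp
qed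

context brw
begin

lemma fixpoint_iter:
  assumes "\<And>z. gen Q z = Q z"
  shows "(gen ^^ n) Q = Q"
proof -
  have "gen Q = Q"
    using assms by auto
  then show ?thesis
    by (induction n) auto
qed

lemma fixpoint_reach_less_1:
  assumes "unit_fun Q" "\<And>z. gen Q z = Q z" "reach \<mu> a b" "Q b < 1"
  shows "Q a < 1"
  using reach_gen_iter_less_1[OF assms(3)] assms(1,4) fixpoint_iter[OF assms(2)] by metis

lemma fixpoint_eq_1:
  assumes Q: "unit_fun Q" and fix_Q: "\<And>z. gen Q z = Q z"
    and fmom_x: "fmom \<mu> x x \<le> 1"
    and C: "C < \<top>" and bound: "\<And>z. reach \<mu> x z \<Longrightarrow> ennreal (1 - Q z) \<le> C * fmom \<mu> x z"
    and comm: "comm \<mu> x y"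
    and standing: "measure_pmf.prob (\<mu> y) {f. (\<Sum>w\<in>{w. comm \<mu> w y \<and> f w \<noteq> 0}. f w) = 1} < 1"
  shows "Q x = 1"
proof (rule ccontr)
  assume "Q x \<noteq> 1"
  then have Qx: "Q x < 1"
    using Q by (simp add: unit_fun_def less_le)
  define v where "v = (\<lambda>z. ennreal (1 - Q z))"
  let ?M = "\<lambda>g z. \<integral>\<^sup>+w. mom \<mu> z w * g w \<partial>count_space UNIV"
  let ?F = "fmom \<mu> x"
  have v_le: "v z \<le> ?M v z" for z
    using one_minus_gen_le[OF Q, of z] by (simp add: v_def fix_Q)
  have v_pos: "v z > 0 \<longleftrightarrow> Q z < 1" for z
    by (simp add: v_def)
  have vx: "v x > 0" "v x < \<top>"
    using Qx by (auto simp: v_def)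
  have F_fin: "?F z < \<top>" if "reach \<mu> x z" for z
    using that unfolding reach_def
  proof (induction rule: rtranclp_induct)
    case base
    show ?case
      using fmom_x by (rule le_less_trans) simp
  next
    case (step z w)
    show ?case
    proof (cases "w = x")
      case True
      then show ?thesis
        using fmom_x by (auto intro: le_less_trans)
    next
      case False
      have "mom \<mu> z w * ?F w \<le> ?F z"
        using taboo_ge[OF False, of \<mu> z ?F] by (subst (2) fmom_eq) (simp add: add_increasing)
      then have "mom \<mu> z w * ?F w < \<top>"
        using step.IH by (rule le_less_trans)
      then show ?thesis
        using step.hyps(2) by (metis ennreal_mult_top mult.commute less_irrefl top.not_eq_extremum)
    qed
  qed
  have iter: "v z \<le> v x * (\<Sum>k<n. fret \<mu> x k z) + C * (\<Sum>k. fret \<mu> x (k + n) z)"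
    if "reach \<mu> x z" for n z
    using that
  proof (induction n arbitrary: z)
    case 0
    then show ?case
      using bound[of z] by (simp add: v_def fmom_def)
  next
    case (Suc n)
    have "v z \<le> mom \<mu> z x * v x + taboo \<mu> x v z"
      using v_le[of z] by (simp only: nn_integral_mom_split[where x=x])
    also have "taboo \<mu> x v z \<le> taboo \<mu> x (\<lambda>w. v x * (\<Sum>k<n. fret \<mu> x k w) + C * (\<Sum>k. fret \<mu> x (k + n) w)) z"
      by (intro taboo_mono Suc.IH reach_step[OF Suc.prems])
    also have "\<dots> = v x * (\<Sum>k<n. fret \<mu> x (Suc k) z) + C * (\<Sum>k. fret \<mu> x (k + Suc n) z)"
      by (simp add: taboo_add taboo_cmult taboo_sum taboo_suminf)
    finally show ?case
      by (simp del: sum.lessThan_Suc add: sum.lessThan_Suc_shift distrib_left ac_simps add_left_mono)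
  qed
  have v_le_F: "v z \<le> v x * ?F z" if "reach \<mu> x z" for z
  proof (rule LIMSEQ_le_const)
    show "(\<lambda>n. v x * ?F z + C * (\<Sum>k. fret \<mu> x (k + n) z)) \<longlonglongrightarrow> v x * ?F z"
      using tendsto_add[OF tendsto_const ennreal_tendsto_cmult[OF C fret_tail_tendsto_0[OF F_fin[OF that]]]]
      by simp
    have "(\<Sum>k<n. fret \<mu> x k z) \<le> ?F z" for n
      unfolding fmom_def by (rule sum_le_suminf) auto
    then show "\<exists>N. \<forall>n\<ge>N. v z \<le> v x * ?F z + C * (\<Sum>k. fret \<mu> x (k + n) z)"
      by (blast intro: order_trans[OF iter[OF that]] add_right_mono mult_left_mono zero_le)
  qed
  have F_x: "?F x = 1"
  proof (rule antisym[OF fmom_x])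
    have "v x * 1 \<le> v x * ?F x"
      using v_le_F[OF reach_refl] by simp
    then show "1 \<le> ?F x"
      using vx ennreal_mult_le_mult_iff[of "v x" 1 "?F x"] by (metis less_irrefl)
  qed
  have F_eq: "?F z = ?M ?F z" for z
    by (subst fmom_eq) (simp add: nn_integral_mom_split[where x=x] F_x)
  have cM: "?M (\<lambda>w. v x * ?F w) z = v x * ?F z" for z
    by (subst F_eq, subst nn_integral_cmult[symmetric]) (auto simp: ac_simps)
  have v_Mv: "?M v z = v z \<and> v x * ?F z = v z" if "reach \<mu> x z" "v z = v x * ?F z" for z
  proof -
    have "?M v z \<le> ?M (\<lambda>w. v x * ?F w) z"
      using that(1) by (intro nn_integral_mom_mono v_le_F) (rule reach_step)
    then have "?M v z \<le> v z"
      by (simp only: cM that(2)[symmetric])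
    then show ?thesis
      using v_le[of z] that by auto
  qed
  have v_eq: "v z = v x * ?F z" if "reach \<mu> x z" for z
    using that unfolding reach_def
  proof (induction rule: rtranclp_induct)
    case base
    show ?case
      by (simp add: F_x)
  next
    case (step z w)
    have z: "reach \<mu> x z"
      using step.hyps(1) by (simp add: reach_def)
    show ?case
    proof (rule nn_integral_mom_eq_imp[where \<mu>=\<mu> and z=z])
      show "v w \<le> v x * ?F w" if "mom \<mu> z w > 0" for w
        by (rule v_le_F[OF reach_step[OF z that]])
      show "?M (\<lambda>w. v x * ?F w) z \<le> ?M v z"
        using v_Mv[OF z step.IH] by (simp add: cM)
      show "?M v z < \<top>"
        using v_Mv[OF z step.IH] by (simp add: v_def)
    qed fact
  qed
  have F_pos: "?F z > 0 \<longleftrightarrow> Q z < 1" if "reach \<mu> x z" for z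
    using v_eq[OF that] v_pos[of z] vx by (simp add: ennreal_zero_less_mult_iff)
  define ind where "ind = (\<lambda>w. ennreal (if Q w < 1 then 1 else 0))"
  have children: "(\<integral>\<^sup>+w. of_nat (f w) * ind w \<partial>count_space UNIV) = of_nat (\<Sum>w\<in>{w \<in> supp f. Q w < 1}. f w)"
    if "f \<in> set_pmf (\<mu> z)" for f z
  proof -
    have "(\<integral>\<^sup>+w. of_nat (f w) * ind w \<partial>count_space UNIV) =
        ennreal (\<Sum>w\<in>supp f. real (f w) * (if Q w < 1 then 1 else 0))"
      unfolding ind_def by (rule offspring_eq_sum[OF fin_supp[OF that]]) simp
    also have "(\<Sum>w\<in>supp f. real (f w) * (if Q w < 1 then 1 else 0)) = (\<Sum>w\<in>{w \<in> supp f. Q w < 1}. real (f w))"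
      using fin_supp[OF that] by (simp add: sum.inter_filter if_distrib cong: if_cong)
    finally show ?thesis
      by (simp add: ennreal_of_nat_eq_real_of_nat)
  qed
  have children_le: "(\<integral>\<^sup>+w. of_nat (f w) * ind w \<partial>count_space UNIV) \<le> 1"
    if "reach \<mu> x z" "f \<in> set_pmf (\<mu> z)" for f z
  proof -
    have "?M v z \<le> ennreal (1 - gen Q z)"
      using v_Mv[OF that(1) v_eq[OF that(1)]] by (simp add: v_def fix_Q)
    then have "(\<Sum>w\<in>{w \<in> supp f. Q w < 1}. f w) \<le> 1"
      by (intro one_minus_gen_eq_imp[OF Q _ that(2)]) (simp add: v_def)
    then show ?thesis
      using of_nat_mono[of "\<Sum>w\<in>{w \<in> supp f. Q w < 1}. f w" 1, where 'a=ennreal]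
      by (simp only: children[OF that(2)] of_nat_1)
  qed
  have M_ind: "?M ind z \<le> 1" if "reach \<mu> x z" for z
  proof -
    have "?M ind z \<le> (\<integral>\<^sup>+f. 1 \<partial>measure_pmf (\<mu> z))"
      unfolding nn_integral_offspring
      by (intro nn_integral_mono_AE) (auto simp: AE_measure_pmf_iff children_le[OF that])
    then show ?thesis
      by simp
  qed
  have F_le_ind: "?F z \<le> ind z" if "reach \<mu> x z" for z
  proof (cases "Q z < 1")
    case False
    then show ?thesis
      using F_pos[OF that] by simp
  next
    case True
    have "(\<Sum>k<n. fret \<mu> x k z) \<le> 1" if "reach \<mu> x z" for n z
      using that
    proof (induction n arbitrary: z)
      case (Suc n)
      have "(\<Sum>k<Suc n. fret \<mu> x k z) = mom \<mu> z x * ind x + taboo \<mu> x (\<lambda>w. \<Sum>k<n. fret \<mu> x k w) z"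
        using Qx by (simp del: sum.lessThan_Suc add: sum.lessThan_Suc_shift taboo_sum ind_def)
      also have "\<dots> \<le> mom \<mu> z x * ind x + taboo \<mu> x ind z"
      proof (intro add_left_mono taboo_mono)
        fix w assume "mom \<mu> z w > 0"
        then have w: "reach \<mu> x w"
          by (rule reach_step[OF Suc.prems])
        show "(\<Sum>k<n. fret \<mu> x k w) \<le> ind w"
        proof (cases "Q w < 1")
          case True
          then show ?thesis
            using Suc.IH[OF w] by (simp add: ind_def)
        next
          case False
          have "(\<Sum>k<n. fret \<mu> x k w) \<le> ?F w"
            unfolding fmom_def by (rule sum_le_suminf) auto
          also have "?F w = 0"
            using F_pos[OF w] False by simp
          finally show ?thesis
            by simp
        qed
      qed
      also have "\<dots> = ?M ind z"
        by (simp only: nn_integral_mom_split[where x=x])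
      also have "\<dots> \<le> 1"
        by (rule M_ind[OF Suc.prems])
      finally show ?case .
    qed simp
    then have "?F z \<le> 1"
      unfolding fmom_def suminf_eq_SUP using that by (intro SUP_least) auto
    then show ?thesis
      using True by (simp add: ind_def)
  qed
  have M_F_le: "?M ?F z \<le> ?M ind z" if "reach \<mu> x z" for z
    using that by (intro nn_integral_mom_mono F_le_ind) (rule reach_step)
  have F_1: "?F z = 1" if "reach \<mu> x z" "?F z > 0" for z
    using that unfolding reach_def
  proof (induction rule: rtranclp_induct)
    case base
    show ?case
      by (rule F_x)
  next
    case (step z w)
    have z: "reach \<mu> x z"
      using step.hyps(1) by (simp add: reach_def)
    have w: "reach \<mu> x w"
      using z step.hyps(2) by (rule reach_step)
    have "?F z = 1"
      using step.IH fmom_pos[OF step.hyps(2)] step.prems by blast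
    then have "?M ?F z = 1"
      using F_eq[of z] by simp
    have "?F w = ind w"
    proof (rule nn_integral_mom_eq_imp[where \<mu>=\<mu> and z=z])
      show "?F w \<le> ind w" if "mom \<mu> z w > 0" for w
        by (rule F_le_ind[OF reach_step[OF z that]])
    qed (use M_ind[OF z] \<open>?M ?F z = 1\<close> step.hyps(2) in auto)
    then show ?case
      using F_pos[OF w] step.prems by (simp add: ind_def)
  qed
  have reach: "reach \<mu> x y" "reach \<mu> y x"
    using comm by (auto simp: comm_def)
  have "Q y < 1"
    by (rule fixpoint_reach_less_1[OF Q fix_Q reach(2) Qx])
  then have "?F y = 1"
    using F_1[OF reach(1)] F_pos[OF reach(1)] by simp
  then have M_1: "1 \<le> ?M ind y"
    using M_F_le[OF reach(1)] F_eq[of y] by simp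
  have "AE f in measure_pmf (\<mu> y). (\<integral>\<^sup>+w. of_nat (f w) * ind w \<partial>count_space UNIV) = 1"
    using M_1 M_ind[OF reach(1)] unfolding nn_integral_offspring
    by (intro nn_integral_eq_imp_AE_eq)
       (auto simp: AE_measure_pmf_iff children_le[OF reach(1)] intro: le_less_trans)
  then have one: "(\<Sum>w\<in>{w \<in> supp f. Q w < 1}. f w) = 1" if "f \<in> set_pmf (\<mu> y)" for f
    using that by (simp add: AE_measure_pmf_iff children del: of_nat_sum)
  have "{w. comm \<mu> w y \<and> f w \<noteq> 0} = {w \<in> supp f. Q w < 1}" if f: "f \<in> set_pmf (\<mu> y)" for f
  proof -
    have "comm \<mu> w y \<longleftrightarrow> Q w < 1" if "f w \<noteq> 0" for w
    proof -
      have w: "reach \<mu> y w"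
        using reach_step[OF reach_refl, of \<mu> y w] f that by (auto simp: mom_pos_iff)
      show ?thesis
      proof
        assume "comm \<mu> w y"
        then have "reach \<mu> w x"
          using reach(2) by (auto simp: comm_def intro: reach_trans)
        then show "Q w < 1"
          by (rule fixpoint_reach_less_1[OF Q fix_Q _ Qx])
      next
        assume "Q w < 1"
        then have "reach \<mu> w x"
          using F_pos[OF reach_trans[OF reach(1) w]] by (intro fmom_pos_imp_reach) simp
        then show "comm \<mu> w y"
          using w reach(1) by (auto simp: comm_def intro: reach_trans)
      qed
    qed
    then show ?thesis
      by (auto simp: supp_def)
  qed
  then have "AE f in measure_pmf (\<mu> y). f \<in> {f. (\<Sum>w\<in>{w. comm \<mu> w y \<and> f w \<noteq> 0}. f w) = 1}"
    using one by (simp add: AE_measure_pmf_iff)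
  then have "measure_pmf.prob (\<mu> y) {f. (\<Sum>w\<in>{w. comm \<mu> w y \<and> f w \<noteq> 0}. f w) = 1} = 1"
    by (subst measure_pmf.prob_eq_1) auto
  then show False
    using standing by simp
qed

end

section \<open>Local survival\<close>

lemma power_one_minus_le:
  fixes t :: real
  assumes "0 \<le> t" "t \<le> 1"
  shows "(1 - t) ^ m \<le> 1 - t * real m + (t * real m)\<^sup>2"
proof -
  let ?a = "t * real m"
  have a: "0 \<le> ?a"
    using assms by simp
  have "1 + ?a \<le> (1 + t) ^ m"
    using Bernoulli_inequality[of t m] assms by (simp add: mult.commute)
  then have "(1 - t) ^ m * (1 + ?a) \<le> (1 - t) ^ m * (1 + t) ^ m"
    using assms by (intro mult_left_mono) auto
  also have "\<dots> = ((1 - t) * (1 + t)) ^ m"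
    by (simp add: power_mult_distrib)
  also have "\<dots> \<le> 1"
    using assms by (intro power_le_one) (auto simp: algebra_simps mult_le_one power2_eq_square[symmetric] power_le_one)
  also have "1 \<le> 1 + ?a ^ 3"
    using a by simp
  also have "\<dots> = (1 - ?a + ?a\<^sup>2) * (1 + ?a)"
    by (simp add: algebra_simps power2_eq_square power3_eq_cube)
  finally show ?thesis
    using a by (simp add: mult_le_cancel_right)
qed

lemma pw_single:
  assumes "finite (supp g)"
  shows "pw (\<lambda>z. if z = w then c else 1) g = c ^ g w"
proof -
  have "pw (\<lambda>z. if z = w then c else 1) g = (\<Prod>z\<in>insert w (supp g). (if z = w then c else 1) ^ g z)"
    using assms by (intro pw_superset) auto
  also have "\<dots> = (\<Prod>z\<in>insert w (supp g). if z = w then c ^ g w else 1)"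
    by (intro prod.cong) auto
  also have "\<dots> = c ^ g w"
    using assms by (subst prod.delta) auto
  finally show ?thesis .
qed

context brw
begin

lemma truncated_mean_gt_1:
  assumes "mom_pow \<mu> n w w > 1"
  obtains K where "P.expectation (\<lambda>\<omega>. real (min (brw_config w \<omega> n w) K)) > 1"
proof -
  let ?X = "\<lambda>\<omega>. brw_config w \<omega> n w"
  let ?f = "\<lambda>K \<omega>. of_nat (min (?X \<omega>) K) :: ennreal"
  have sup: "(SUP K. ?f K \<omega>) = of_nat (?X \<omega>)" for \<omega>
  proof (rule antisym)
    show "(SUP K. ?f K \<omega>) \<le> of_nat (?X \<omega>)"
      by (intro SUP_least) (simp add: of_nat_mono)
    show "of_nat (?X \<omega>) \<le> (SUP K. ?f K \<omega>)"
      by (rule SUP_upper2[of "?X \<omega>"]) auto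
  qed
  have [measurable]: "?f K \<in> borel_measurable \<Omega>" for K
    by (rule measurable_compose[OF measurable_brw_config]) simp
  have "incseq ?f"
    by (auto simp: incseq_def le_fun_def intro!: of_nat_mono)
  then have "(\<integral>\<^sup>+\<omega>. (SUP K. ?f K \<omega>) \<partial>\<Omega>) = (SUP K. \<integral>\<^sup>+\<omega>. ?f K \<omega> \<partial>\<Omega>)"
    by (intro nn_integral_monotone_convergence_SUP) auto
  then have "1 < (SUP K. \<integral>\<^sup>+\<omega>. ?f K \<omega> \<partial>\<Omega>)"
    using assms by (simp only: sup nn_integral_config)
  then obtain K where K: "1 < (\<integral>\<^sup>+\<omega>. ?f K \<omega> \<partial>\<Omega>)"
    by (auto simp: less_SUP_iff)
  have int: "integrable \<Omega> (\<lambda>\<omega>. real (min (?X \<omega>) K))"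
    by (rule P.integrable_const_bound[where B="real K"]) auto
  have "(\<integral>\<^sup>+\<omega>. ?f K \<omega> \<partial>\<Omega>) = (\<integral>\<^sup>+\<omega>. ennreal (real (min (?X \<omega>) K)) \<partial>\<Omega>)"
    by (simp only: ennreal_of_nat_eq_real_of_nat)
  also have "\<dots> = ennreal (P.expectation (\<lambda>\<omega>. real (min (?X \<omega>) K)))"
    by (rule nn_integral_eq_integral[OF int]) auto
  finally have "P.expectation (\<lambda>\<omega>. real (min (?X \<omega>) K)) > 1"
    using K by (simp only: ennreal_less_iff[of 1, simplified] flip: ennreal_1) simp
  then show thesis
    by (rule that)
qed

lemma supercritical_gen_iter_le:
  assumes "mom_pow \<mu> n w w > 1"
  obtains t0 where "0 < t0" "t0 \<le> 1"
    "\<And>t. 0 \<le> t \<Longrightarrow> t \<le> t0 \<Longrightarrow> (gen ^^ n) (\<lambda>z. if z = w then 1 - t else 1) w \<le> 1 - t"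
proof -
  let ?X = "\<lambda>\<omega>. brw_config w \<omega> n w"
  obtain K where K: "P.expectation (\<lambda>\<omega>. real (min (?X \<omega>) K)) > 1"
    using truncated_mean_gt_1[OF assms] by blast
  define e where "e = P.expectation (\<lambda>\<omega>. real (min (?X \<omega>) K))"
  have int[simp]: "integrable \<Omega> (\<lambda>\<omega>. real (min (?X \<omega>) K))"
    by (rule P.integrable_const_bound[where B="real K"]) auto
  define t0 where "t0 = min 1 ((e - 1) / ((real K)\<^sup>2 + 1))"
  have K1: "(real K)\<^sup>2 + 1 > 0"
    by (simp add: add_nonneg_pos)
  show thesis
  proof
    show "0 < t0" "t0 \<le> 1"
      using K K1 by (auto simp: t0_def e_def)
    fix t assume t: "0 \<le> t" "t \<le> t0"
    let ?h = "\<lambda>z. if z = w then 1 - t else 1"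
    have t1: "t \<le> 1"
      using t by (simp add: t0_def)
    have h: "unit_fun ?h"
      using t t1 by (auto simp: unit_fun_def)
    have "t * ((real K)\<^sup>2 + 1) \<le> e - 1"
      using t K1 by (simp add: t0_def pos_le_divide_eq)
    then have tK: "t * (real K)\<^sup>2 \<le> e - 1"
      using t by (simp add: algebra_simps)
    have nonneg: "0 \<le> 1 - t * real (min (?X \<omega>) K) + (t * real K)\<^sup>2" for \<omega>
    proof -
      have "0 \<le> (1 - t) ^ min (?X \<omega>) K"
        using t1 by simp
      also have "\<dots> \<le> 1 - t * real (min (?X \<omega>) K) + (t * real (min (?X \<omega>) K))\<^sup>2"
        by (rule power_one_minus_le[OF t(1) t1])
      also have "\<dots> \<le> 1 - t * real (min (?X \<omega>) K) + (t * real K)\<^sup>2"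
        using t by (intro add_left_mono power_mono mult_left_mono) auto
      finally show ?thesis .
    qed
    have "ennreal ((gen ^^ n) ?h w) = (\<integral>\<^sup>+\<omega>. ennreal (pw ?h (brw_config w \<omega> n)) \<partial>\<Omega>)"
      by (rule nn_integral_pw_config[OF h, symmetric])
    also have "\<dots> \<le> (\<integral>\<^sup>+\<omega>. ennreal (1 - t * real (min (?X \<omega>) K) + (t * real K)\<^sup>2) \<partial>\<Omega>)"
    proof (rule nn_integral_mono_AE, use AE_finite_supp_config[of w n] in eventually_elim)
      fix \<omega> assume "finite (supp (brw_config w \<omega> n))"
      then have "pw ?h (brw_config w \<omega> n) = (1 - t) ^ ?X \<omega>"
        by (rule pw_single)
      also have "\<dots> \<le> (1 - t) ^ min (?X \<omega>) K"
        using t t1 by (intro power_decreasing) auto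
      also have "\<dots> \<le> 1 - t * real (min (?X \<omega>) K) + (t * real (min (?X \<omega>) K))\<^sup>2"
        by (rule power_one_minus_le[OF t(1) t1])
      also have "\<dots> \<le> 1 - t * real (min (?X \<omega>) K) + (t * real K)\<^sup>2"
        using t by (intro add_left_mono power_mono mult_left_mono) auto
      finally show "ennreal (pw ?h (brw_config w \<omega> n)) \<le> ennreal (1 - t * real (min (?X \<omega>) K) + (t * real K)\<^sup>2)"
        by (rule ennreal_leI)
    qed
    also have "\<dots> = ennreal (P.expectation (\<lambda>\<omega>. 1 - t * real (min (?X \<omega>) K) + (t * real K)\<^sup>2))"
      using nonneg by (intro nn_integral_eq_integral) auto
    also have "P.expectation (\<lambda>\<omega>. 1 - t * real (min (?X \<omega>) K) + (t * real K)\<^sup>2) = 1 - t * e + (t * real K)\<^sup>2"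
      by (simp add: e_def P.prob_space[simplified])
    finally have "ennreal ((gen ^^ n) ?h w) \<le> ennreal (1 - t * e + (t * real K)\<^sup>2)" .
    moreover have le: "1 - t * e + (t * real K)\<^sup>2 \<le> 1 - t"
      using mult_left_mono[OF tK t(1)] by (simp add: algebra_simps power2_eq_square)
    ultimately have "ennreal ((gen ^^ n) ?h w) \<le> ennreal (1 - t)"
      by (meson ennreal_leI order_trans)
    then show "(gen ^^ n) ?h w \<le> 1 - t"
      using t1 by simp
  qed
qed

lemma q_less_1_of_supercritical:
  assumes "reach \<mu> x w" "reach \<mu> w y" "Ms \<mu> w w > 1"
  shows "q x y < 1"
proof -
  obtain n where n: "n > 0" "mom_pow \<mu> n w w > 1"
    using assms(3) by (auto simp: Ms_gt_1_iff)
  obtain t0 where t0: "0 < t0" "t0 \<le> 1"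
    "\<And>t. 0 \<le> t \<Longrightarrow> t \<le> t0 \<Longrightarrow> (gen ^^ n) (\<lambda>z. if z = w then 1 - t else 1) w \<le> 1 - t"
    using supercritical_gen_iter_le[OF n(2)] by blast
  obtain l where l: "\<And>h. unit_fun h \<Longrightarrow> h y < 1 \<Longrightarrow> (gen ^^ l) h w < 1"
    using reach_gen_iter_less_1[OF assms(2)] by blast
  obtain r where r: "\<And>h. unit_fun h \<Longrightarrow> h w < 1 \<Longrightarrow> (gen ^^ r) h x < 1"
    using reach_gen_iter_less_1[OF assms(1)] by blast
  let ?a = "avoid y 0"
  have a: "unit_fun ?a"
    by (rule avoid_unit)
  have aw: "(gen ^^ l) ?a w < 1"
    by (rule l[OF a]) simp
  define t where "t = min t0 (1 - (gen ^^ l) ?a w)"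
  have t: "0 < t" "t \<le> t0" "t \<le> 1 - (gen ^^ l) ?a w"
    using aw t0 by (auto simp: t_def)
  define h where "h = (\<lambda>z. if z = w then 1 - t else 1)"
  have h: "unit_fun h"
    using t t0 by (auto simp: h_def unit_fun_def)
  have step: "(gen ^^ n) h z \<le> h z" for z
    using t0(3)[of t] t gen_iter_unit[OF h, of n] by (auto simp: h_def unit_fun_def)
  have iter: "(gen ^^ (n * k)) h z \<le> h z" for k z
  proof (induction k arbitrary: z)
    case (Suc k)
    have "(gen ^^ (n * Suc k)) h z = (gen ^^ (n * k)) ((gen ^^ n) h) z"
      by (simp only: mult_Suc_right add.commute[of n] funpow_add o_apply)
    also have "\<dots> \<le> (gen ^^ (n * k)) h z"
      by (intro gen_iter_mono gen_iter_unit h step)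
    finally show ?case
      using Suc[of z] by simp
  qed simp
  have le: "(gen ^^ l) ?a z \<le> h z" for z
    using t gen_iter_unit[OF a, of l] by (auto simp: h_def unit_fun_def)
  have "(gen ^^ (r + (n * k + l))) ?a x \<le> (gen ^^ r) h x" for k
  proof -
    have "(gen ^^ (n * k)) ((gen ^^ l) ?a) z \<le> h z" for z
      by (rule order_trans[OF gen_iter_mono[OF gen_iter_unit[OF a] h le] iter])
    then have "(gen ^^ r) ((gen ^^ (n * k)) ((gen ^^ l) ?a)) x \<le> (gen ^^ r) h x"
      by (intro gen_iter_mono gen_iter_unit a h)
    then show ?thesis
      by (simp only: funpow_add o_apply)
  qed
  moreover have "N \<le> r + (n * N + l)" for N
    using n(1) by (simp add: trans_le_add1 trans_le_add2)
  ultimately have "q x y \<le> (gen ^^ r) h x"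
    by (intro q_leI) blast
  also have "\<dots> < 1"
    using t by (intro r h) (simp add: h_def)
  finally show ?thesis .
qed

end

lemma finite_bound_by_multiple:
  fixes F :: "'a \<Rightarrow> ennreal"
  assumes "finite D" "\<And>z. z \<in> D \<Longrightarrow> F z > 0"
  shows "\<exists>C<\<top>. \<forall>z\<in>D. 1 \<le> C * F z"
  using assms
proof (induction D rule: finite_induct)
  case empty
  show ?case
    by (intro exI[of _ 0]) simp
next
  case (insert a D)
  then obtain C where C: "C < \<top>" "\<forall>z\<in>D. 1 \<le> C * F z"
    by auto
  obtain r where r: "ennreal r = min 1 (F a)" "r > 0"
    using insert.prems[of a] by (cases "min 1 (F a)") (auto simp: min_def split: if_splits)
  let ?c = "ennreal (1 / r)"
  have "1 = ?c * ennreal r"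
    using r(2) by (subst ennreal_mult[symmetric]) auto
  also have "\<dots> \<le> ?c * F a"
    unfolding r(1) by (intro mult_left_mono) auto
  finally have "1 \<le> ?c * F a" .
  then have "1 \<le> (C + ?c) * F a"
    by (simp add: distrib_right add_increasing)
  moreover have "1 \<le> (C + ?c) * F z" if "z \<in> D" for z
    using C(2) that by (simp add: distrib_right add_increasing2)
  moreover have "C + ?c < \<top>"
    using C(1) by simp
  ultimately show ?case
    by (intro exI[of _ "C + ?c"]) auto
qed

locale brw_standing = brw +
  assumes standing: "\<exists>v. comm \<mu> z v \<and>
    measure_pmf.prob (\<mu> v) {f. (\<Sum>w\<in>{w. comm \<mu> w v \<and> f w \<noteq> 0}. f w) = 1} < 1"
begin

lemma fixpoint_eq_1_of_subcritical:
  assumes "unit_fun Q" "\<And>z. gen Q z = Q z" "\<not> Ms \<mu> x x > 1" "C < \<top>"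
    "\<And>z. reach \<mu> x z \<Longrightarrow> ennreal (1 - Q z) \<le> C * fmom \<mu> x z"
  shows "Q x = 1"
  using standing[of x] fixpoint_eq_1[OF assms(1,2) fmom_le_1[OF assms(3)] assms(4,5)] by blast

lemma q_self_eq_1:
  assumes "\<not> Ms \<mu> x x > 1"
  shows "q x x = 1"
  using fixpoint_eq_1_of_subcritical[OF q_unit q_fixpoint assms, of 1] one_minus_q_le_fmom[of _ x]
  by simp

text \<open>Among the sites between \<open>x\<close> and \<open>y\<close> from which \<open>y\<close> survives locally, choose one that can reach
  as few of the others as possible: it communicates with every such site that it can reach.\<close>

lemma q_eq_1_of_finite:
  assumes fin: "finite {w. reach \<mu> x w \<and> reach \<mu> w y}"
    and sub: "\<And>w. reach \<mu> x w \<Longrightarrow> reach \<mu> w y \<Longrightarrow> \<not> Ms \<mu> w w > 1"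
  shows "q x y = 1"
proof (rule ccontr)
  assume "q x y \<noteq> 1"
  define Q where "Q = (\<lambda>z. q z y)"
  have Q: "unit_fun Q"
    unfolding Q_def by (rule q_unit)
  have fix_Q: "gen Q z = Q z" for z
    unfolding Q_def by (rule q_fixpoint)
  have Qx: "Q x < 1"
    using \<open>q x y \<noteq> 1\<close> Q by (simp add: Q_def unit_fun_def less_le)
  have Q_reach: "reach \<mu> z y" if "Q z < 1" for z
  proof (rule fmom_pos_imp_reach)
    have "0 < ennreal (1 - Q z)"
      using that by simp
    also have "\<dots> \<le> fmom \<mu> y z"
      unfolding Q_def by (rule one_minus_q_le_fmom)
    finally show "fmom \<mu> y z > 0" .
  qed
  define S where "S = {w. reach \<mu> x w \<and> Q w < 1}"
  have "finite S"
    by (rule finite_subset[OF _ fin]) (auto simp: S_def Q_reach)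
  define R where "R = (\<lambda>w. {z \<in> S. reach \<mu> w z})"
  have finR: "finite (R w)" for w
    using \<open>finite S\<close> by (simp add: R_def)
  have "x \<in> S"
    using Qx by (simp add: S_def reach_refl)
  then obtain w where w: "w \<in> S" "\<And>z. z \<in> S \<Longrightarrow> card (R w) \<le> card (R z)"
    using ex_has_least_nat[of "\<lambda>w. w \<in> S" x "\<lambda>w. card (R w)"] by blast
  have return: "reach \<mu> z w" if "z \<in> R w" for z
  proof -
    have "R z \<subseteq> R w"
    proof
      fix u assume "u \<in> R z"
      then show "u \<in> R w"
        using that reach_trans[of \<mu> w z u] by (simp add: R_def)
    qed
    moreover have "card (R w) \<le> card (R z)"
      using that w(2) by (simp add: R_def)
    ultimately have "R z = R w"
      using finR by (metis card_seteq)
    moreover have "w \<in> R w"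
      using w(1) by (simp add: R_def reach_refl)
    ultimately have "w \<in> R z"
      by (simp only:)
    then show ?thesis
      by (simp add: R_def)
  qed
  have S_reach: "z \<in> R w" if "reach \<mu> w z" "Q z < 1" for z
    using that w(1) reach_trans[of \<mu> x w z] by (simp add: R_def S_def)
  have pos: "fmom \<mu> w z > 0" if "z \<in> R w" for z
  proof -
    have z: "reach \<mu> w z" "Q z < 1"
      using that by (auto simp: R_def S_def)
    have "\<exists>z'. mom \<mu> z z' > 0 \<and> Q z' < 1"
    proof (rule ccontr)
      assume "\<not> ?thesis"
      then have zero: "mom \<mu> z z' * ennreal (1 - Q z') = 0" for z'
        by (cases "mom \<mu> z z' = 0") (auto simp: zero_less_iff_neq_zero ennreal_eq_0_iff not_less)
      have "ennreal (1 - Q z) \<le> 0"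
        using one_minus_gen_le[OF Q, of z] unfolding fix_Q zero by simp
      then show False
        using z(2) by (simp add: ennreal_eq_0_iff)
    qed
    then obtain z' where z': "mom \<mu> z z' > 0" "Q z' < 1"
      by auto
    have "z' \<in> R w"
      using reach_step[OF z(1) z'(1)] z'(2) by (rule S_reach)
    then have "(\<lambda>a b. mom \<mu> a b > 0)\<^sup>+\<^sup>+ z w"
      using return[of z'] z'(1) by (auto simp: reach_def intro: rtranclp_into_tranclp2)
    then show ?thesis
      by (induction rule: converse_tranclp_induct) (auto intro: fmom_pos)
  qed
  obtain C where C: "C < \<top>" "\<forall>z\<in>R w. 1 \<le> C * fmom \<mu> w z"
    using finite_bound_by_multiple[OF finR[of w], of "fmom \<mu> w"] pos by auto
  have "Q w = 1"
  proof (rule fixpoint_eq_1_of_subcritical[OF Q fix_Q _ C(1)])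
    show "\<not> Ms \<mu> w w > 1"
      using w(1) sub[of w] Q_reach[of w] by (simp add: S_def)
    fix z assume z: "reach \<mu> w z"
    show "ennreal (1 - Q z) \<le> C * fmom \<mu> w z"
    proof (cases "Q z < 1")
      case True
      have "ennreal (1 - Q z) \<le> 1"
        using Q by (simp add: unit_fun_def)
      also have "1 \<le> C * fmom \<mu> w z"
        using C(2) S_reach[OF z True] by blast
      finally show ?thesis .
    next
      case False
      then have "ennreal (1 - Q z) = 0"
        by (simp add: ennreal_eq_0_iff)
      then show ?thesis
        by simp
    qed
  qed
  then show False
    using w(1) by (simp add: S_def)
qed

end

theorem mainTheorem2:
  fixes \<mu> :: "'x::countable \<Rightarrow> ('x \<Rightarrow> nat) pmf" and x y :: 'x
  assumes fin_supp: "\<forall>z. \<forall>f\<in>set_pmf (\<mu> z). finite {w. f w \<noteq> 0}"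
    and standing: "\<forall>z. \<exists>v. comm \<mu> z v \<and>
        measure_pmf.prob (\<mu> v) {f. (\<Sum>w\<in>{w. comm \<mu> w v \<and> f w \<noteq> 0}. f w) = 1} < 1"
  shows "(q_ext \<mu> x x < 1 \<longleftrightarrow> Ms \<mu> x x > 1)
    \<and> ((\<Squnion>w\<in>{w. reach \<mu> x w \<and> reach \<mu> w y}. Ms \<mu> w w) > 1 \<longrightarrow> q_ext \<mu> x y < 1)
    \<and> (finite {w. reach \<mu> x w \<and> reach \<mu> w y} \<longrightarrow> q_ext \<mu> x y < 1 \<longrightarrow>
         (\<Squnion>w\<in>{w. reach \<mu> x w \<and> reach \<mu> w y}. Ms \<mu> w w) > 1)"
proof -
  interpret brw_standing \<mu>
  proof unfold_locales
    show "finite (supp f)" if "f \<in> set_pmf (\<mu> z)" for z f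
      using fin_supp that by (simp add: supp_def)
  qed (use standing in simp)
  show ?thesis
  proof (intro conjI impI iffI)
    show "Ms \<mu> x x > 1" if "q_ext \<mu> x x < 1"
      using q_self_eq_1[of x] that by (metis less_irrefl)
    show "q_ext \<mu> x x < 1" if "Ms \<mu> x x > 1"
      by (rule q_less_1_of_supercritical[OF reach_refl reach_refl that])
    show "q_ext \<mu> x y < 1" if "(\<Squnion>w\<in>{w. reach \<mu> x w \<and> reach \<mu> w y}. Ms \<mu> w w) > 1"
      using that by (auto simp: less_SUP_iff intro: q_less_1_of_supercritical)
    show "(\<Squnion>w\<in>{w. reach \<mu> x w \<and> reach \<mu> w y}. Ms \<mu> w w) > 1"
      if "finite {w. reach \<mu> x w \<and> reach \<mu> w y}" "q_ext \<mu> x y < 1"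
      using q_eq_1_of_finite[OF that(1)] that(2) by (auto simp: less_SUP_iff)
  qed
qed

end
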